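(* Let $\alpha,\gamma\in\mathbb{C}$ and $\Delta\in\mathbb{C}^*$. Nontrivial extensions of conformal $\mathcal{R}$-modules of the form $$0\longrightarrow \mathbb{C}c_\gamma\longrightarrow E\longrightarrow V(\alpha,\Delta)\longrightarrow 0$$ exist if and only if $\alpha+\gamma=0$ and $\Delta$ is either $1$ or $2$. In these cases, they are given (up to equivalence) by $E=\mathbb{C}c_\gamma\oplus\mathbb{C}[\partial]v_\Delta$ (direct sum of $\mathbb{C}[\partial]$-modules, with $\mathbb{C}c_\gamma$ an $\mathcal{R}$-submodule) with $$L_\lambda v_\Delta=(\partial+\alpha+\Delta\lambda)v_\Delta+f(\lambda)c_\gamma,\qquad I_\lambda v_\Delta=g(\lambda)c_\gamma,$$ where (i) for $\Delta=1$: $g(\lambda)=0$ and $f(\lambda)=b_2\lambda^2$, with $b_2\neq 0$; (ii) for $\Delta=2$: $g(\lambda)=0$ and $f(\lambda)=b_3\lambda^3$, with $b_3\neq 0$. The corresponding spaces $\mathrm{Ext}(V(\alpha,1),\mathbb{C}c_{-\alpha})$ and $\mathrm{Ext}(V(\alpha,2),\mathbb{C}c_{-\alpha})$ are $1$-dimensional.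
   Context: $\mathcal{R}=\mathbb{C}[\partial]L\oplus\mathbb{C}[\partial]I$ is the Lie conformal algebra, free of rank $2$ over $\mathbb{C}[\partial]$, with $[L_\lambda L]=(\partial+2\lambda)(L+I)$, $[L_\lambda I]=(\partial+\lambda)I$, $[I_\lambda L]=\lambda I$, $[I_\lambda I]=0$. A conformal module $V$ over $\mathcal{R}$ is a $\mathbb{C}[\partial]$-module with a $\mathbb{C}$-linear map $\mathcal{R}\to \mathrm{End}_{\mathbb{C}}(V)\otimes\mathbb{C}[\lambda]$, $a\mapsto a_\lambda$, such that $a_\lambda b_\mu-b_\mu a_\lambda=[a_\lambda b]_{\lambda+\mu}$ and $(\partial a)_\lambda=[\partial,a_\lambda]=-\lambda a_\lambda$ (so $a_\lambda(\partial v)=(\partial+\lambda)a_\lambda v$). $V(\alpha,\Delta)=\mathbb{C}[\partial]v_\Delta$ is the module free of rank one over $\mathbb{C}[\partial]$ with $L_\lambda v_\Delta=(\partial+\alpha+\Delta\lambda)v_\Delta$, $I_\lambda v_\Delta=0$. $\mathbb{C}c_\gamma$ is the $1$-dimensional module with $L_\lambda c_\gamma=I_\lambda c_\gamma=0$, $\partial c_\gamma=\gamma c_\gamma$. An extension of $W$ by $V$ is an exact sequence of $\mathcal{R}$-modules $0\to V\to E\to W\to 0$. Two extensions $E,E'$ of $W$ by $V$ are equivalent if there is a module homomorphism $\psi:E\to E'$ compatible with the identity maps of $V$ and $W$. An extension is trivial if it is equivalent to the direct sum $V\oplus W$. Writing $E=V\oplus W$ as a vector space, an extension is described by a cocycle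 (the $V$-valued correction to the action on $W$); cocycles form a vector space, coboundaries are the cocycles of trivial extensions, and $\mathrm{Ext}(W,V)$ is the quotient of the space of cocycles by the subspace of coboundaries. *)

theory Defs
  imports
    Complex_Main
    "HOL-Computational_Algebra.Polynomial"
    "HOL-Library.Function_Algebras"
    "HOL-Library.Product_Plus"
begin

text \<open>
  Since \<open>\<complex>\<close> is infinite, a polynomial in \<open>\<lambda>\<close> with coefficients in a complex vector space is
  determined by its values. Hence elements of \<open>V[\<lambda>]\<close> are represented throughout as polynomial
  functions of a complex number \<open>\<lambda>\<close>, and identities in \<open>\<lambda>\<close>, \<open>\<mu>\<close> are required for all complex
  values.
\<close>

section \<open>The Lie conformal algebra\<close>

text \<open>The pair \<open>(p, q)\<close> stands for \<open>p(\<partial>) L + q(\<partial>) I\<close>.\<close>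

type_synonym lca = "complex poly \<times> complex poly"

definition gen_L :: lca where "gen_L = (1, 0)"

definition gen_I :: lca where "gen_I = (0, 1)"

definition lca_scale :: "complex \<Rightarrow> lca \<Rightarrow> lca" where
  "lca_scale c a = (smult c (fst a), smult c (snd a))"

definition lca_del :: "lca \<Rightarrow> lca" where
  "lca_del a = ([:0, 1:] * fst a, [:0, 1:] * snd a)"

text \<open>\<open>poly_shift \<lambda> h\<close> is \<open>h(\<partial> + \<lambda>)\<close>.\<close>

definition poly_shift :: "complex \<Rightarrow> complex poly \<Rightarrow> complex poly" where
  "poly_shift l h = pcompose h [:l, 1:]"

text \<open>
  The value at \<open>\<lambda>\<close> of \<open>[a \<^sub>\<lambda> b]\<close>, extended from the generators by
  \<open>[p(\<partial>)a \<^sub>\<lambda> q(\<partial>)b] = p(-\<lambda>) q(\<partial> + \<lambda>) [a \<^sub>\<lambda> b]\<close>; see the lemmas below.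
\<close>

definition lca_bracket :: "complex \<Rightarrow> lca \<Rightarrow> lca \<Rightarrow> lca" where
  "lca_bracket l a b =
     (smult (poly (fst a) (- l)) (poly_shift l (fst b) * [:2 * l, 1:]),
      smult (poly (fst a) (- l)) (poly_shift l (fst b) * [:2 * l, 1:])
      + smult (poly (fst a) (- l)) (poly_shift l (snd b) * [:l, 1:])
      + smult (poly (snd a) (- l)) (poly_shift l (fst b) * [:l:]))"

lemma lca_bracket_generators:
  "lca_bracket l gen_L gen_L =
     lca_del (gen_L + gen_I) + lca_scale (2 * l) (gen_L + gen_I)"
  "lca_bracket l gen_L gen_I = lca_del gen_I + lca_scale l gen_I"
  "lca_bracket l gen_I gen_L = lca_scale l gen_I"
  "lca_bracket l gen_I gen_I = 0"
  by (simp_all add: lca_bracket_def gen_L_def gen_I_def lca_del_def lca_scale_def poly_shift_def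
      zero_prod_def one_pCons)

lemma lca_bracket_sesquilinear:
  "lca_bracket l (lca_del a) b = lca_scale (- l) (lca_bracket l a b)"
  "lca_bracket l a (lca_del b) = lca_del (lca_bracket l a b) + lca_scale l (lca_bracket l a b)"
  by (simp_all add: lca_bracket_def lca_del_def lca_scale_def poly_shift_def
      pcompose_mult pcompose_pCons algebra_simps smult_add_right)

lemma lca_bracket_bilinear:
  "lca_bracket l (a + a') b = lca_bracket l a b + lca_bracket l a' b"
  "lca_bracket l a (b + b') = lca_bracket l a b + lca_bracket l a b'"
  "lca_bracket l (lca_scale c a) b = lca_scale c (lca_bracket l a b)"
  "lca_bracket l a (lca_scale c b) = lca_scale c (lca_bracket l a b)"
  by (simp_all add: lca_bracket_def lca_scale_def poly_shift_def
      pcompose_add pcompose_smult algebra_simps smult_add_right smult_add_left)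

section \<open>Conformal modules\<close>

text \<open>
  A \<open>\<complex>[\<partial>]\<close>-module is a complex vector space with a linear operator \<open>\<partial>\<close>;
  \<open>cm_act M a \<lambda> v\<close> is the value of \<open>a\<^sub>\<lambda> v\<close> at the complex number \<open>\<lambda>\<close>.
\<close>

record 'v conf_mod =
  cm_scale :: "complex \<Rightarrow> 'v \<Rightarrow> 'v"
  cm_del :: "'v \<Rightarrow> 'v"
  cm_act :: "lca \<Rightarrow> complex \<Rightarrow> 'v \<Rightarrow> 'v"

text \<open>
  The degree in \<open>\<lambda>\<close> of \<open>a\<^sub>\<lambda> v\<close> may depend on \<open>v\<close>: a bound uniform in \<open>v\<close> would be
  incompatible with \<open>a\<^sub>\<lambda>(\<partial>v) = (\<partial> + \<lambda>) a\<^sub>\<lambda> v\<close> on free modules.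
\<close>

definition conformal_module :: "'v::ab_group_add conf_mod \<Rightarrow> bool" where
  "conformal_module M \<longleftrightarrow>
     vector_space (cm_scale M) \<and>
     Vector_Spaces.linear (cm_scale M) (cm_scale M) (cm_del M) \<and>
     (\<forall>a l. Vector_Spaces.linear (cm_scale M) (cm_scale M) (cm_act M a l)) \<and>
     (\<forall>l v. Vector_Spaces.linear lca_scale (cm_scale M) (\<lambda>a. cm_act M a l v)) \<and>
     (\<forall>a v. \<exists>(n::nat) c. \<forall>l. cm_act M a l v = (\<Sum>k\<le>n. cm_scale M (l ^ k) (c k))) \<and>
     (\<forall>a b l m v. cm_act M a l (cm_act M b m v) - cm_act M b m (cm_act M a l v)
                  = cm_act M (lca_bracket l a b) (l + m) v) \<and>
     (\<forall>a l v. cm_act M (lca_del a) l v = cm_del M (cm_act M a l v) - cm_act M a l (cm_del M v)) \<and>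
     (\<forall>a l v. cm_act M (lca_del a) l v = cm_scale M (- l) (cm_act M a l v))"

definition cm_hom ::
  "'v::ab_group_add conf_mod \<Rightarrow> 'w::ab_group_add conf_mod \<Rightarrow> ('v \<Rightarrow> 'w) \<Rightarrow> bool" where
  "cm_hom M N f \<longleftrightarrow>
     Vector_Spaces.linear (cm_scale M) (cm_scale N) f \<and>
     (\<forall>v. f (cm_del M v) = cm_del N (f v)) \<and>
     (\<forall>a l v. f (cm_act M a l v) = cm_act N a l (f v))"

text \<open>The polynomial \<open>h\<close> stands for \<open>h(\<partial>) v\<^sub>\<Delta>\<close>, and
  \<open>L\<^sub>\<lambda> h(\<partial>) v\<^sub>\<Delta> = h(\<partial> + \<lambda>) (\<partial> + \<alpha> + \<Delta>\<lambda>) v\<^sub>\<Delta>\<close>.\<close>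

definition mod_V :: "complex \<Rightarrow> complex \<Rightarrow> complex poly conf_mod" where
  "mod_V \<alpha> \<Delta> =
     \<lparr>cm_scale = smult,
      cm_del = (\<lambda>h. [:0, 1:] * h),
      cm_act = (\<lambda>a l h. smult (poly (fst a) (- l)) (poly_shift l h * [:\<alpha> + \<Delta> * l, 1:]))\<rparr>"

definition mod_C :: "complex \<Rightarrow> complex conf_mod" where
  "mod_C \<gamma> = \<lparr>cm_scale = (*), cm_del = (*) \<gamma>, cm_act = (\<lambda>a l c. 0)\<rparr>"

section \<open>Extensions\<close>

text \<open>The sequence \<open>0 \<longlongrightarrow> V \<longlongrightarrow> E \<longlongrightarrow> W \<longlongrightarrow> 0\<close> with maps \<open>i\<close> and \<open>p\<close> is exact.\<close>

definition is_extension ::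
  "'v::ab_group_add conf_mod \<Rightarrow> 'w::ab_group_add conf_mod \<Rightarrow>
   'e::ab_group_add conf_mod \<Rightarrow> ('v \<Rightarrow> 'e) \<Rightarrow> ('e \<Rightarrow> 'w) \<Rightarrow> bool" where
  "is_extension V W E i p \<longleftrightarrow>
     conformal_module V \<and> conformal_module W \<and> conformal_module E \<and>
     cm_hom V E i \<and> cm_hom E W p \<and>
     inj i \<and> range i = {x. p x = 0} \<and> surj p"

definition ext_equiv ::
  "'e::ab_group_add conf_mod \<Rightarrow> ('v \<Rightarrow> 'e) \<Rightarrow> ('e \<Rightarrow> 'w) \<Rightarrow>
   'f::ab_group_add conf_mod \<Rightarrow> ('v \<Rightarrow> 'f) \<Rightarrow> ('f \<Rightarrow> 'w) \<Rightarrow> bool" where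
  "ext_equiv E i p E' i' p' \<longleftrightarrow>
     (\<exists>\<psi>. cm_hom E E' \<psi> \<and> (\<forall>v. \<psi> (i v) = i' v) \<and> (\<forall>x. p' (\<psi> x) = p x))"

definition direct_sum :: "'v conf_mod \<Rightarrow> 'w conf_mod \<Rightarrow> ('v \<times> 'w) conf_mod" where
  "direct_sum V W =
     \<lparr>cm_scale = (\<lambda>c x. (cm_scale V c (fst x), cm_scale W c (snd x))),
      cm_del = (\<lambda>x. (cm_del V (fst x), cm_del W (snd x))),
      cm_act = (\<lambda>a l x. (cm_act V a l (fst x), cm_act W a l (snd x)))\<rparr>"

definition incl :: "'v \<Rightarrow> 'v \<times> 'w::zero" where "incl v = (v, 0)"

definition trivial_ext ::
  "'v::ab_group_add conf_mod \<Rightarrow> 'w::ab_group_add conf_mod \<Rightarrow>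
   'e::ab_group_add conf_mod \<Rightarrow> ('v \<Rightarrow> 'e) \<Rightarrow> ('e \<Rightarrow> 'w) \<Rightarrow> bool" where
  "trivial_ext V W E i p \<longleftrightarrow> ext_equiv E i p (direct_sum V W) incl snd"

definition nontrivial_ext ::
  "'v::ab_group_add conf_mod \<Rightarrow> 'w::ab_group_add conf_mod \<Rightarrow>
   'e::ab_group_add conf_mod \<Rightarrow> ('v \<Rightarrow> 'e) \<Rightarrow> ('e \<Rightarrow> 'w) \<Rightarrow> bool" where
  "nontrivial_ext V W E i p \<longleftrightarrow> is_extension V W E i p \<and> \<not> trivial_ext V W E i p"

text \<open>
  The pair \<open>(c, h)\<close> stands for \<open>c c\<^sub>\<gamma> + h(\<partial>) v\<^sub>\<Delta>\<close>. The action is determined by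
  \<open>L\<^sub>\<lambda> v\<^sub>\<Delta> = (\<partial> + \<alpha> + \<Delta>\<lambda>) v\<^sub>\<Delta> + f(\<lambda>) c\<^sub>\<gamma>\<close> and \<open>I\<^sub>\<lambda> v\<^sub>\<Delta> = g(\<lambda>) c\<^sub>\<gamma>\<close>, using
  \<open>a\<^sub>\<lambda> h(\<partial>) v\<^sub>\<Delta> = h(\<partial> + \<lambda>) a\<^sub>\<lambda> v\<^sub>\<Delta>\<close> and \<open>h(\<partial> + \<lambda>) c\<^sub>\<gamma> = h(\<gamma> + \<lambda>) c\<^sub>\<gamma>\<close>.
\<close>

definition mod_E ::
  "complex \<Rightarrow> complex \<Rightarrow> complex \<Rightarrow> complex poly \<Rightarrow> complex poly \<Rightarrow>
   (complex \<times> complex poly) conf_mod" where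
  "mod_E \<alpha> \<gamma> \<Delta> f g =
     \<lparr>cm_scale = (\<lambda>c x. (c * fst x, smult c (snd x))),
      cm_del = (\<lambda>x. (\<gamma> * fst x, [:0, 1:] * snd x)),
      cm_act = (\<lambda>a l x.
        (poly (snd x) (\<gamma> + l) * (poly (fst a) (- l) * poly f l + poly (snd a) (- l) * poly g l),
         smult (poly (fst a) (- l)) (poly_shift l (snd x) * [:\<alpha> + \<Delta> * l, 1:])))\<rparr>"

lemma mod_E_generators:
  "cm_act (mod_E \<alpha> \<gamma> \<Delta> f g) gen_L l (0, 1) = (poly f l, [:0, 1:] + [:\<alpha> + \<Delta> * l:])"
  "cm_act (mod_E \<alpha> \<gamma> \<Delta> f g) gen_I l (0, 1) = (poly g l, 0)"
  by (simp_all add: mod_E_def gen_L_def gen_I_def poly_shift_def one_pCons pcompose_pCons)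

section \<open>Cocycles and Ext\<close>

text \<open>
  The vector space \<open>V \<times> W\<close> with the actions on \<open>W\<close> corrected by \<open>V\<close>-valued terms: the component
  \<open>d\<close> corrects \<open>\<partial>\<close>, and \<open>\<phi>\<close> corrects the actions \<open>a\<^sub>\<lambda>\<close>.
\<close>

type_synonym ('v, 'w) cochain = "('w \<Rightarrow> 'v) \<times> (lca \<Rightarrow> complex \<Rightarrow> 'w \<Rightarrow> 'v)"

definition cochain_mod ::
  "'v::ab_group_add conf_mod \<Rightarrow> 'w conf_mod \<Rightarrow> ('v, 'w) cochain \<Rightarrow> ('v \<times> 'w) conf_mod" where
  "cochain_mod V W z =
     \<lparr>cm_scale = (\<lambda>c x. (cm_scale V c (fst x), cm_scale W c (snd x))),
      cm_del = (\<lambda>x. (cm_del V (fst x) + fst z (snd x), cm_del W (snd x))),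
      cm_act = (\<lambda>a l x. (cm_act V a l (fst x) + snd z a l (snd x), cm_act W a l (snd x)))\<rparr>"

definition cocycles ::
  "'w::ab_group_add conf_mod \<Rightarrow> 'v::ab_group_add conf_mod \<Rightarrow> ('v, 'w) cochain set" where
  "cocycles W V = {z. is_extension V W (cochain_mod V W z) incl snd}"

definition coboundaries ::
  "'w::ab_group_add conf_mod \<Rightarrow> 'v::ab_group_add conf_mod \<Rightarrow> ('v, 'w) cochain set" where
  "coboundaries W V = {z \<in> cocycles W V. trivial_ext V W (cochain_mod V W z) incl snd}"

definition cochain_scale ::
  "'v conf_mod \<Rightarrow> complex \<Rightarrow> ('v, 'w) cochain \<Rightarrow> ('v, 'w) cochain" where
  "cochain_scale V c z = (\<lambda>w. cm_scale V c (fst z w), \<lambda>a l w. cm_scale V c (snd z a l w))"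

text \<open>The elements of \<open>Z/B\<close> are the cosets \<open>x + B\<close>, and \<open>c (x + B) = c x + B\<close>.\<close>

definition quot_space :: "'a::ab_group_add set \<Rightarrow> 'a set \<Rightarrow> 'a set set" where
  "quot_space Z B = (\<lambda>x. {x + b |b. b \<in> B}) ` Z"

definition quot_scale ::
  "(complex \<Rightarrow> 'a::ab_group_add \<Rightarrow> 'a) \<Rightarrow> 'a set \<Rightarrow> complex \<Rightarrow> 'a set \<Rightarrow> 'a set" where
  "quot_scale s B c X = {s c x + b |x b. x \<in> X \<and> b \<in> B}"

text \<open>\<open>Z/B\<close> is a quotient of vector spaces and has a basis \<open>{e}\<close>.\<close>

definition quot_one_dimensional ::
  "(complex \<Rightarrow> 'a::ab_group_add \<Rightarrow> 'a) \<Rightarrow> 'a set \<Rightarrow> 'a set \<Rightarrow> bool" where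
  "quot_one_dimensional s Z B \<longleftrightarrow>
     vector_space s \<and> module.subspace s Z \<and> module.subspace s B \<and> B \<subseteq> Z \<and>
     (\<exists>e \<in> quot_space Z B. \<forall>X \<in> quot_space Z B. \<exists>!c. X = quot_scale s B c e)"

definition Ext_one_dimensional ::
  "'w::ab_group_add conf_mod \<Rightarrow> 'v::ab_group_add conf_mod \<Rightarrow> bool" where
  "Ext_one_dimensional W V \<longleftrightarrow>
     quot_one_dimensional (cochain_scale V) (cocycles W V) (coboundaries W V)"

end

theory Submission
  imports Defs
begin

text \<open>
  Let \<open>E\<close> be an extension of \<open>V(\<alpha>, \<Delta>)\<close> by \<open>\<complex>c\<^sub>\<gamma>\<close> and put \<open>s = \<alpha> + \<gamma>\<close>. As a \<open>\<complex>[\<partial>]\<close>-module,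
  \<open>V(\<alpha>, \<Delta>)\<close> is free on \<open>v\<^sub>\<Delta>\<close>, so any preimage of \<open>v\<^sub>\<Delta>\<close> in \<open>E\<close> spans a \<open>\<complex>[\<partial>]\<close>-linear section.
  Transporting the structure of \<open>E\<close> along this section turns it into a module \<open>mod_E\<close> with
  polynomials \<open>f\<close> and \<open>g\<close> (\<open>extension_equiv_mod_E\<close>). Changing the preimage by \<open>b c\<^sub>\<gamma>\<close> changes
  \<open>f\<close> by a multiple of \<open>s + \<Delta>\<lambda>\<close> and leaves \<open>g\<close> alone; nothing else can happen under an
  equivalence (\<open>ext_equiv_mod_E_iff\<close>).

  The commutator relation holds in \<open>mod_E\<close> exactly when
  \<open>(s + \<lambda> + \<Delta>\<mu>) f(\<lambda>) - (s + \<mu> + \<Delta>\<lambda>) f(\<mu>) = (\<lambda> - \<mu>) (f(\<lambda> + \<mu>) + g(\<lambda> + \<mu>))\<close> and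
  \<open>(s + \<mu> + \<Delta>\<lambda>) g(\<mu>) = \<mu> g(\<lambda> + \<mu>)\<close>
  (\<open>E_cocycle_in_cocycles_iff\<close>). As \<open>\<Delta> \<noteq> 0\<close>, the second equation forces \<open>g(x) = x g(1)\<close>, with \<open>g \<noteq> 0\<close> only
  for \<open>s = 0\<close>, \<open>\<Delta> = 1\<close>, and there the first equation rules it out. With \<open>g = 0\<close>, putting
  \<open>\<mu> = 0\<close> in the first equation gives \<open>s f(\<lambda>) = (s + \<Delta>\<lambda>) f(0)\<close>, so \<open>f\<close> is a coboundary unless
  \<open>s = 0\<close>. For \<open>s = 0\<close> the \<open>\<mu>\<close>-derivative at \<open>\<mu> = 0\<close> is an Euler equation, which leaves beside
  the coboundary only a monomial of degree \<open>n = \<Delta> + 1 \<ge> 2\<close>; evaluation at \<open>\<lambda> = 2\<close>, \<open>\<mu> = 1\<close>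
  then gives \<open>(n + 1) 2\<^sup>n + 1 = 3\<^sup>n + 2 n\<close>, which excludes \<open>n \<ge> 4\<close> (\<open>L_cocycle_eq_cases\<close>).
  Both \<open>\<lambda>\<^sup>2\<close> for \<open>\<Delta> = 1\<close> and \<open>\<lambda>\<^sup>3\<close> for \<open>\<Delta> = 2\<close> do solve the equation, and neither is a multiple
  of \<open>\<Delta>\<lambda>\<close>.

  The dimension of Ext concerns arbitrary cocycles, which may also correct \<open>\<partial>\<close>. They
  are covered by applying the same classification to the extension that the cocycle defines: it is
  equivalent to the one of \<open>c \<lambda>\<^sup>n\<close> for some \<open>c\<close>, and equivalent cocycles differ by a coboundary
  (\<open>equivalent_cocycles_diff\<close>).
\<close>

section \<open>Polynomial functions and linear maps\<close>

lemma poly_ext: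
  fixes p q :: "complex poly"
  assumes "\<And>x. poly p x = poly q x"
  shows "p = q"
proof -
  have "poly p = poly q"
    using assms by (rule ext)
  then show ?thesis
    by (simp only: poly_eq_poly_eq_iff)
qed

definition polynomial_in :: "(complex \<Rightarrow> 'v \<Rightarrow> 'v) \<Rightarrow> (complex \<Rightarrow> 'v::ab_group_add) \<Rightarrow> bool" where
  "polynomial_in s F \<longleftrightarrow> (\<exists>(n::nat) c. \<forall>l. F l = (\<Sum>k\<le>n. s (l ^ k) (c k)))"

lemma polynomial_in_linear_image:
  assumes "Vector_Spaces.linear s t h" "polynomial_in s F"
  shows "polynomial_in t (\<lambda>l. h (F l))"
proof -
  interpret Vector_Spaces.linear s t h by fact
  obtain n c where "\<And>l. F l = (\<Sum>k\<le>(n::nat). s (l ^ k) (c k))"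
    using assms(2) by (auto simp: polynomial_in_def)
  then have "h (F l) = (\<Sum>k\<le>n. t (l ^ k) (h (c k)))" for l
    by (simp add: sum scale)
  then show ?thesis
    by (auto simp: polynomial_in_def)
qed

lemma polynomial_in_add:
  assumes "vector_space s" "polynomial_in s F" "polynomial_in s G"
  shows "polynomial_in s (\<lambda>l. F l + G l)"
proof -
  interpret vector_space s by fact
  obtain n c where F: "\<And>l. F l = (\<Sum>k\<le>(n::nat). s (l ^ k) (c k))"
    using assms(2) by (auto simp: polynomial_in_def)
  obtain m d where G: "\<And>l. G l = (\<Sum>k\<le>(m::nat). s (l ^ k) (d k))"
    using assms(3) by (auto simp: polynomial_in_def)
  define c' where "c' k = (if k \<le> n then c k else 0)" for k
  define d' where "d' k = (if k \<le> m then d k else 0)" for k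
  have "F l = (\<Sum>k\<le>max n m. s (l ^ k) (c' k))" "G l = (\<Sum>k\<le>max n m. s (l ^ k) (d' k))" for l
    unfolding F G by (intro sum.mono_neutral_cong_left; auto simp: c'_def d'_def)+
  then have "F l + G l = (\<Sum>k\<le>max n m. s (l ^ k) (c' k + d' k))" for l
    by (simp add: scale_right_distrib sum.distrib)
  then show ?thesis
    by (auto simp: polynomial_in_def)
qed

lemma polynomial_in_complex_iff:
  "polynomial_in (*) F \<longleftrightarrow> (\<exists>p. \<forall>l. F l = poly p l)"
proof
  assume "polynomial_in (*) F"
  then obtain n c where "\<And>l. F l = (\<Sum>k\<le>(n::nat). l ^ k * c k)"
    by (auto simp: polynomial_in_def)
  then have "F l = poly (\<Sum>k\<le>n. monom (c k) k) l" for l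
    by (simp add: poly_sum poly_monom mult.commute)
  then show "\<exists>p. \<forall>l. F l = poly p l" by blast
next
  assume "\<exists>p. \<forall>l. F l = poly p l"
  then obtain p where "\<And>l. F l = poly p l" by blast
  then show "polynomial_in (*) F"
    unfolding polynomial_in_def poly_altdef
    by (intro exI[of _ "degree p"] exI[of _ "coeff p"]) (simp add: mult.commute)
qed

text \<open>
  A polynomial in \<open>\<lambda>\<close> with values in \<open>\<complex>[\<partial>]\<close> is best seen as a polynomial over the ring \<open>\<complex>[\<partial>]\<close>,
  evaluated at the constant \<open>\<lambda>\<close>: closure under sums and products then comes for free.
\<close>

lemma polynomial_in_smult_if_bivariate:
  assumes "\<And>l. F l = poly G [:l:]"
  shows "polynomial_in smult F"
proof -
  have "F l = (\<Sum>k\<le>degree G. smult (l ^ k) (coeff G k))" for l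
    unfolding assms poly_altdef by (intro sum.cong) (simp_all add: poly_const_pow)
  then show ?thesis
    by (auto simp: polynomial_in_def)
qed

lemma vector_space_smult: "vector_space (smult :: 'a::field \<Rightarrow> 'a poly \<Rightarrow> 'a poly)"
  by unfold_locales (simp_all add: smult_add_right smult_add_left)

lemma vector_space_times: "vector_space ((*) :: 'a::field \<Rightarrow> 'a \<Rightarrow> 'a)"
  by unfold_locales (simp_all add: algebra_simps)

lemma vector_space_prod:
  assumes "vector_space s" "vector_space t"
  shows "vector_space (\<lambda>c x. (s c (fst x), t c (snd x)))"
proof -
  interpret s: vector_space s by fact
  interpret t: vector_space t by fact
  show ?thesis
    by unfold_locales (auto simp: s.scale_right_distrib s.scale_left_distrib
        t.scale_right_distrib t.scale_left_distrib)
qed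

text \<open>
  The next two lemmas say that \<open>\<complex>[\<partial>]\<close> is the free \<open>\<complex>[\<partial>]\<close>-module on \<open>1\<close>, where \<open>\<partial>\<close> acts on the
  target by \<open>D\<close>.
\<close>

lemma poly_linear_map_ext:
  fixes \<sigma> \<tau> :: "complex poly \<Rightarrow> 'v::ab_group_add"
  assumes "Vector_Spaces.linear smult s \<sigma>" "Vector_Spaces.linear smult s \<tau>"
    and "\<sigma> 1 = \<tau> 1"
    and "\<And>h. \<sigma> ([:0, 1:] * h) = D (\<sigma> h)" "\<And>h. \<tau> ([:0, 1:] * h) = D (\<tau> h)"
  shows "\<sigma> h = \<tau> h"
proof (induction h)
  case 0
  show ?case
    by (metis assms(1,2) Vector_Spaces.linear.axioms(3) module_hom.zero)
next
  case (pCons a h)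
  have h: "pCons a h = smult a 1 + [:0, 1:] * h"
    by (simp add: one_pCons)
  have "f (pCons a h) = s a (f 1) + f ([:0, 1:] * h)" if "Vector_Spaces.linear smult s f" for f
    using that unfolding h Vector_Spaces.linear_iff by metis
  from this[OF assms(1)] this[OF assms(2)] show ?case
    using assms(3) pCons.IH by (simp only: assms(4,5))
qed

lemma poly_linear_map_exists:
  fixes s :: "complex \<Rightarrow> 'v::ab_group_add \<Rightarrow> 'v"
  assumes D: "Vector_Spaces.linear s s D"
  obtains \<sigma> where "Vector_Spaces.linear smult s \<sigma>" "\<sigma> 1 = e"
    "\<And>h. \<sigma> ([:0, 1:] * h) = D (\<sigma> h)"
proof -
  have vs: "vector_space s" using D unfolding Vector_Spaces.linear_iff by blast
  interpret S: vector_space s by (rule vs)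
  interpret D: Vector_Spaces.linear s s D by (rule D)
  define \<sigma> where "\<sigma> h = (\<Sum>k\<le>degree h. s (coeff h k) ((D ^^ k) e))" for h
  have \<sigma>: "\<sigma> h = (\<Sum>k\<le>n. s (coeff h k) ((D ^^ k) e))" if "degree h \<le> n" for h n
    unfolding \<sigma>_def using that
    by (intro sum.mono_neutral_left) (auto simp: coeff_eq_0)
  have "\<sigma> (g + h) = \<sigma> g + \<sigma> h" for g h
    unfolding \<sigma>[of g "max (degree g) (degree h)", OF max.cobounded1]
      \<sigma>[of h "max (degree g) (degree h)", OF max.cobounded2]
      \<sigma>[of "g + h" "max (degree g) (degree h)", OF degree_add_le_max]
    by (simp add: S.scale_left_distrib sum.distrib)
  moreover have "\<sigma> (smult c h) = s c (\<sigma> h)" for c h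
    unfolding \<sigma>_def[of h] \<sigma>[OF degree_smult_le] by (simp add: S.scale_sum_right)
  ultimately have "Vector_Spaces.linear smult s \<sigma>"
    unfolding Vector_Spaces.linear_iff using vs vector_space_smult by blast
  moreover have "\<sigma> 1 = e" by (simp add: \<sigma>_def)
  moreover have "\<sigma> ([:0, 1:] * h) = D (\<sigma> h)" for h
  proof -
    have "degree ([:0, 1:] * h) \<le> Suc (degree h)"
      by (simp add: degree_pCons_le)
    from \<sigma>[OF this] show ?thesis
      by (simp add: sum.atMost_Suc_shift \<sigma>_def[of h] D.sum D.scale del: sum.atMost_Suc)
  qed
  ultimately show thesis by (rule that)
qed

section \<open>Conformal modules and their homomorphisms\<close>

lemma vector_space_lca_scale: "vector_space lca_scale"
  by unfold_locales (auto simp: lca_scale_def smult_add_right smult_add_left)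

text \<open>
  The conformal module axioms with each linearity condition spelled out, so that they can be
  checked and used one equation at a time.
\<close>

lemma conformal_module_iff:
  "conformal_module M \<longleftrightarrow>
     vector_space (cm_scale M) \<and>
     (\<forall>v w. cm_del M (v + w) = cm_del M v + cm_del M w) \<and>
     (\<forall>c v. cm_del M (cm_scale M c v) = cm_scale M c (cm_del M v)) \<and>
     (\<forall>a l v w. cm_act M a l (v + w) = cm_act M a l v + cm_act M a l w) \<and>
     (\<forall>a l c v. cm_act M a l (cm_scale M c v) = cm_scale M c (cm_act M a l v)) \<and>
     (\<forall>l v a b. cm_act M (a + b) l v = cm_act M a l v + cm_act M b l v) \<and>
     (\<forall>l v c a. cm_act M (lca_scale c a) l v = cm_scale M c (cm_act M a l v)) \<and>
     (\<forall>a v. polynomial_in (cm_scale M) (\<lambda>l. cm_act M a l v)) \<and>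
     (\<forall>a b l m v. cm_act M a l (cm_act M b m v) - cm_act M b m (cm_act M a l v)
                  = cm_act M (lca_bracket l a b) (l + m) v) \<and>
     (\<forall>a l v. cm_act M (lca_del a) l v = cm_del M (cm_act M a l v) - cm_act M a l (cm_del M v)) \<and>
     (\<forall>a l v. cm_act M (lca_del a) l v = cm_scale M (- l) (cm_act M a l v))"
  unfolding conformal_module_def Vector_Spaces.linear_iff polynomial_in_def
  by (simp only: vector_space_lca_scale all_conj_distrib simp_thms)
    (rule iffI; elim conjE; intro conjI; assumption)

lemma conformal_moduleD:
  assumes "conformal_module M"
  shows "vector_space (cm_scale M)"
    and "cm_del M (v + w) = cm_del M v + cm_del M w"
    and "cm_del M (cm_scale M c v) = cm_scale M c (cm_del M v)"
    and "cm_act M a l (v + w) = cm_act M a l v + cm_act M a l w"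
    and "cm_act M a l (cm_scale M c v) = cm_scale M c (cm_act M a l v)"
    and "cm_act M (a + b) l v = cm_act M a l v + cm_act M b l v"
    and "cm_act M (lca_scale c a) l v = cm_scale M c (cm_act M a l v)"
    and "polynomial_in (cm_scale M) (\<lambda>l. cm_act M a l v)"
    and "cm_act M a l (cm_act M b m v) - cm_act M b m (cm_act M a l v)
       = cm_act M (lca_bracket l a b) (l + m) v"
    and "cm_act M (lca_del a) l v = cm_del M (cm_act M a l v) - cm_act M a l (cm_del M v)"
    and "cm_act M (lca_del a) l v = cm_scale M (- l) (cm_act M a l v)"
proof -
  note A = assms[unfolded conformal_module_iff]
  from A show "vector_space (cm_scale M)" by (elim conjE)
  from A show "polynomial_in (cm_scale M) (\<lambda>l. cm_act M a l v)" by blast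
qed (use assms in \<open>unfold conformal_module_iff, metis\<close>)+

lemma conformal_module_zero:
  assumes "conformal_module M"
  shows "cm_scale M c 0 = 0" "cm_del M 0 = 0" "cm_act M a l 0 = 0"
proof -
  interpret vector_space "cm_scale M"
    by (rule conformal_moduleD(1)[OF assms])
  show "cm_scale M c 0 = 0" by simp
  show "cm_del M 0 = 0" using conformal_moduleD(2)[OF assms, of 0 0] by simp
  show "cm_act M a l 0 = 0" using conformal_moduleD(4)[OF assms, of a l 0 0] by simp
qed

lemma cm_homD:
  assumes "cm_hom M N f"
  shows "Vector_Spaces.linear (cm_scale M) (cm_scale N) f"
    "vector_space (cm_scale M)" "vector_space (cm_scale N)"
    "f (v + w) = f v + f w" "f (cm_scale M c v) = cm_scale N c (f v)"
    "f (cm_del M v) = cm_del N (f v)" "f (cm_act M a l v) = cm_act N a l (f v)"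
  using assms unfolding cm_hom_def Vector_Spaces.linear_iff by blast+

lemma cm_hom_minus:
  assumes "cm_hom M N f"
  shows "f (v - w) = f v - f w"
  using cm_homD(4)[OF assms, of "v - w" w] by (simp add: algebra_simps)

lemma cm_hom_inv:
  assumes f: "cm_hom M N f" and bij: "bij f"
  shows "cm_hom N M (inv f)"
proof -
  have I: "inv f x = y \<longleftrightarrow> x = f y" for x y
    using bij by (metis bij_inv_eq_iff)
  have J: "f (inv f x) = x" for x
    using bij by (simp add: bij_is_surj surj_f_inv_f)
  show ?thesis
    unfolding cm_hom_def Vector_Spaces.linear_iff
    by (intro conjI allI) (simp_all add: I J cm_homD[OF f])
qed

text \<open>
  Every axiom is an equation, hence may be tested after applying the injective \<open>f\<close>; polynomiality
  in \<open>\<lambda>\<close> is pulled back along the linear inverse of \<open>f\<close>.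
\<close>

lemma conformal_module_transport:
  assumes f: "cm_hom M N f" and bij: "bij f" and N: "conformal_module N"
  shows "conformal_module M"
proof -
  have inj: "x = y" if "f x = f y" for x y
    using bij that by (simp add: bij_def inj_def)
  have poly: "polynomial_in (cm_scale M) (\<lambda>l. cm_act M a l v)" for a v
  proof -
    have "polynomial_in (cm_scale N) (\<lambda>l. cm_act N a l (f v))"
      using N unfolding conformal_module_iff by blast
    from polynomial_in_linear_image[OF cm_homD(1)[OF cm_hom_inv[OF f bij]] this]
    show ?thesis
      using bij by (simp flip: cm_homD(7)[OF f] add: bij_is_inj)
  qed
  show ?thesis
    unfolding conformal_module_iff
    by (intro conjI allI; (rule poly cm_homD(2)[OF f]
        | (rule inj, simp only: cm_homD[OF f] cm_hom_minus[OF f], rule conformal_moduleD[OF N])))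
qed

section \<open>Cocycles as corrections to a direct sum\<close>

lemma cochain_mod_simps [simp]:
  "cm_scale (cochain_mod V W z) = (\<lambda>c x. (cm_scale V c (fst x), cm_scale W c (snd x)))"
  "cm_del (cochain_mod V W z) = (\<lambda>x. (cm_del V (fst x) + fst z (snd x), cm_del W (snd x)))"
  "cm_act (cochain_mod V W z) = (\<lambda>a l x. (cm_act V a l (fst x) + snd z a l (snd x), cm_act W a l (snd x)))"
  by (simp_all add: cochain_mod_def)

lemma direct_sum_eq_cochain_mod: "direct_sum V W = cochain_mod V W 0"
  by (simp add: direct_sum_def cochain_mod_def zero_fun_def)

text \<open>
  The conformal module axioms for the corrected direct sum, read off in the first component at
  vectors \<open>(0, w)\<close>. All of them are linear in the cochain, which is why cocycles form a vector
  space.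
\<close>

lemma cocyclesD:
  assumes "z \<in> cocycles W V"
  shows "fst z (v + w) = fst z v + fst z w"
    and "fst z (cm_scale W c w) = cm_scale V c (fst z w)"
    and "snd z a l (v + w) = snd z a l v + snd z a l w"
    and "snd z a l (cm_scale W c w) = cm_scale V c (snd z a l w)"
    and "snd z (a + b) l w = snd z a l w + snd z b l w"
    and "snd z (lca_scale c a) l w = cm_scale V c (snd z a l w)"
    and "polynomial_in (cm_scale V) (\<lambda>l. snd z a l w)"
    and "snd z (lca_bracket l a b) (l + m) w
       = cm_act V a l (snd z b m w) + snd z a l (cm_act W b m w)
         - (cm_act V b m (snd z a l w) + snd z b m (cm_act W a l w))"
    and "snd z (lca_del a) l w
       = cm_del V (snd z a l w) + fst z (cm_act W a l w)
         - (cm_act V a l (fst z w) + snd z a l (cm_del W w))"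
    and "snd z (lca_del a) l w = cm_scale V (- l) (snd z a l w)"
proof -
  have V: "conformal_module V" and W: "conformal_module W"
    and E: "conformal_module (cochain_mod V W z)"
    using assms by (auto simp: cocycles_def is_extension_def)
  note zero = conformal_module_zero[OF V] conformal_module_zero[OF W]
  note E' = conformal_moduleD[OF E, unfolded cochain_mod_simps]
  have "Vector_Spaces.linear (\<lambda>c x. (cm_scale V c (fst x), cm_scale W c (snd x))) (cm_scale V) fst"
    unfolding Vector_Spaces.linear_iff
    using conformal_moduleD(1)[OF V] E'(1) by simp
  from polynomial_in_linear_image[OF this E'(8)[of a "(0, w)"]]
  show "polynomial_in (cm_scale V) (\<lambda>l. snd z a l w)"
    by (simp add: zero)
  show "fst z (v + w) = fst z v + fst z w"
    using arg_cong[OF E'(2)[of "(0, v)" "(0, w)"], of fst] by (simp add: zero)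
  show "fst z (cm_scale W c w) = cm_scale V c (fst z w)"
    using arg_cong[OF E'(3)[of c "(0, w)"], of fst] by (simp add: zero)
  show "snd z a l (v + w) = snd z a l v + snd z a l w"
    using arg_cong[OF E'(4)[of a l "(0, v)" "(0, w)"], of fst] by (simp add: zero)
  show "snd z a l (cm_scale W c w) = cm_scale V c (snd z a l w)"
    using arg_cong[OF E'(5)[of a l c "(0, w)"], of fst] by (simp add: zero)
  show "snd z (a + b) l w = snd z a l w + snd z b l w"
    using arg_cong[OF E'(6)[of a b l "(0, w)"], of fst] by (simp add: zero)
  show "snd z (lca_scale c a) l w = cm_scale V c (snd z a l w)"
    using arg_cong[OF E'(7)[of c a l "(0, w)"], of fst] by (simp add: zero)
  show "snd z (lca_bracket l a b) (l + m) w
      = cm_act V a l (snd z b m w) + snd z a l (cm_act W b m w)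
        - (cm_act V b m (snd z a l w) + snd z b m (cm_act W a l w))"
    using arg_cong[OF E'(9)[of a l b m "(0, w)"], of fst] by (simp add: zero)
  show "snd z (lca_del a) l w
      = cm_del V (snd z a l w) + fst z (cm_act W a l w)
        - (cm_act V a l (fst z w) + snd z a l (cm_del W w))"
    using arg_cong[OF E'(10)[of a l "(0, w)"], of fst] by (simp add: zero)
  show "snd z (lca_del a) l w = cm_scale V (- l) (snd z a l w)"
    using arg_cong[OF E'(11)[of a l "(0, w)"], of fst] by (simp add: zero)
qed

text \<open>
  The inclusion and the projection are module homomorphisms as soon as the corrections vanish at
  \<open>0\<close>, and this already follows from the linearity of the corrected operators.
\<close>

lemma cocycles_iff_conformal_module:
  assumes V: "conformal_module V" and W: "conformal_module W"
  shows "z \<in> cocycles W V \<longleftrightarrow> conformal_module (cochain_mod V W z)"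
proof
  assume "z \<in> cocycles W V"
  then show "conformal_module (cochain_mod V W z)"
    by (simp add: cocycles_def is_extension_def)
next
  assume E: "conformal_module (cochain_mod V W z)"
  note zero = conformal_module_zero[OF V] conformal_module_zero[OF W]
  have "fst z 0 = 0" "snd z a l 0 = 0" for a l
    using conformal_module_zero(2,3)[OF E] by (simp_all add: zero zero_prod_def)
  then have "cm_hom V (cochain_mod V W z) incl" "cm_hom (cochain_mod V W z) W snd"
    unfolding cm_hom_def Vector_Spaces.linear_iff
    using conformal_moduleD(1)[OF V] conformal_moduleD(1)[OF W] conformal_moduleD(1)[OF E]
    by (simp_all add: incl_def zero)
  then show "z \<in> cocycles W V"
    using V W E by (auto simp: cocycles_def is_extension_def inj_def incl_def image_iff)
qed

text \<open>
  Conversely, each axiom at a general vector \<open>(v, w)\<close> is the sum of the axiom of \<open>V\<close> at \<open>v\<close> and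
  the cocycle condition at \<open>w\<close>.
\<close>

lemma cocyclesI:
  assumes V: "conformal_module V" and W: "conformal_module W"
    and "\<And>v w. fst z (v + w) = fst z v + fst z w"
    and "\<And>c w. fst z (cm_scale W c w) = cm_scale V c (fst z w)"
    and "\<And>a l v w. snd z a l (v + w) = snd z a l v + snd z a l w"
    and "\<And>a l c w. snd z a l (cm_scale W c w) = cm_scale V c (snd z a l w)"
    and "\<And>a b l w. snd z (a + b) l w = snd z a l w + snd z b l w"
    and "\<And>c a l w. snd z (lca_scale c a) l w = cm_scale V c (snd z a l w)"
    and "\<And>a w. polynomial_in (cm_scale V) (\<lambda>l. snd z a l w)"
    and "\<And>a b l m w. snd z (lca_bracket l a b) (l + m) w
       = cm_act V a l (snd z b m w) + snd z a l (cm_act W b m w)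
         - (cm_act V b m (snd z a l w) + snd z b m (cm_act W a l w))"
    and "\<And>a l w. snd z (lca_del a) l w
       = cm_del V (snd z a l w) + fst z (cm_act W a l w)
         - (cm_act V a l (fst z w) + snd z a l (cm_del W w))"
    and "\<And>a l w. snd z (lca_del a) l w = cm_scale V (- l) (snd z a l w)"
  shows "z \<in> cocycles W V"
proof -
  note z = assms(3-)
  note V' = conformal_moduleD[OF V] and W' = conformal_moduleD[OF W]
  interpret V: vector_space "cm_scale V" by (rule V'(1))
  interpret W: vector_space "cm_scale W" by (rule W'(1))
  note zero = conformal_module_zero[OF V] conformal_module_zero[OF W]
  let ?s = "\<lambda>c x. (cm_scale V c (fst x), cm_scale W c (snd x))"
  note vs = vector_space_prod[OF V'(1) W'(1)]
  have poly: "polynomial_in ?s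
      (\<lambda>l. (cm_act V a l (fst x) + snd z a l (snd x), cm_act W a l (snd x)))" for a x
  proof -
    have 1: "Vector_Spaces.linear (cm_scale V) ?s (\<lambda>v. (v, 0))"
      and 2: "Vector_Spaces.linear (cm_scale W) ?s (\<lambda>w. (0, w))"
      unfolding Vector_Spaces.linear_iff using V'(1) W'(1) vs by simp_all
    from polynomial_in_add[OF vs polynomial_in_linear_image[OF 1
          polynomial_in_add[OF V'(1) V'(8)[of a "fst x"] z(7)[of a "snd x"]]]
        polynomial_in_linear_image[OF 2 W'(8)[of a "snd x"]]]
    show ?thesis by simp
  qed
  have "conformal_module (cochain_mod V W z)"
    unfolding conformal_module_iff cochain_mod_simps
    by (intro conjI allI; (rule vs poly
      | (rule prod_eqI; simp add: z(1-6) V'(2-7) W'(2-7) V.scale_right_distrib add_ac; fail)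
      | (rule prod_eqI; simp add: z(3,8) V'(4) V'(9)[symmetric] W'(9) algebra_simps; fail)
      | (rule prod_eqI; simp add: z(9) V'(2,4,10) W'(10) algebra_simps; fail)
      | (rule prod_eqI; simp add: z(10) V'(11) W'(11) V.scale_right_distrib; fail)))
  then show ?thesis
    by (simp add: cocycles_iff_conformal_module[OF V W])
qed

lemma vector_space_cochain_scale:
  assumes "vector_space (cm_scale V)"
  shows "vector_space (cochain_scale V)"
proof -
  interpret vector_space "cm_scale V" by fact
  show ?thesis
    by unfold_locales (auto simp: cochain_scale_def fun_eq_iff prod_eq_iff scale_right_distrib scale_left_distrib)
qed

lemma subspace_cocycles:
  assumes V: "conformal_module V" and W: "conformal_module W"
  shows "module.subspace (cochain_scale V) (cocycles W V)"
proof -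
  note V' = conformal_moduleD[OF V] and W' = conformal_moduleD[OF W]
  note zero = conformal_module_zero[OF V] conformal_module_zero[OF W]
  interpret V: vector_space "cm_scale V" by (rule V'(1))
  interpret Z: vector_space "cochain_scale V" by (rule vector_space_cochain_scale[OF V'(1)])
  have "0 \<in> cocycles W V"
    by (rule cocyclesI[OF V W])
      (auto simp: zero polynomial_in_def intro!: exI[of _ "\<lambda>_. 0"])
  moreover have "x + y \<in> cocycles W V" if x: "x \<in> cocycles W V" and y: "y \<in> cocycles W V" for x y
  proof (rule cocyclesI[OF V W]; unfold fst_add snd_add plus_fun_apply)
    fix a l m b w
    show "polynomial_in (cm_scale V) (\<lambda>l. snd x a l w + snd y a l w)" for a w
      by (intro polynomial_in_add V'(1) cocyclesD(7)[OF x] cocyclesD(7)[OF y])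
  next
    show "snd x (lca_bracket l a b) (l + m) w + snd y (lca_bracket l a b) (l + m) w =
       cm_act V a l (snd x b m w + snd y b m w) + (snd x a l (cm_act W b m w) + snd y a l (cm_act W b m w))
       - (cm_act V b m (snd x a l w + snd y a l w) + (snd x b m (cm_act W a l w) + snd y b m (cm_act W a l w)))"
      for a b l m w
      by (simp add: cocyclesD(8)[OF x] cocyclesD(8)[OF y] V'(4))
  next
    show "snd x (lca_del a) l w + snd y (lca_del a) l w
       = cm_del V (snd x a l w + snd y a l w) + (fst x (cm_act W a l w) + fst y (cm_act W a l w))
         - (cm_act V a l (fst x w + fst y w) + (snd x a l (cm_del W w) + snd y a l (cm_del W w)))" for a l w
      by (simp add: cocyclesD(9)[OF x] cocyclesD(9)[OF y] V'(2,4))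
  qed (simp_all add: cocyclesD(1-6)[OF x] cocyclesD(1-6)[OF y] cocyclesD(10)[OF x] cocyclesD(10)[OF y] V.scale_right_distrib)
  moreover have "cochain_scale V c x \<in> cocycles W V" if x: "x \<in> cocycles W V" for c x
  proof (rule cocyclesI[OF V W]; unfold cochain_scale_def fst_conv snd_conv)
    have "Vector_Spaces.linear (cm_scale V) (cm_scale V) (cm_scale V c)"
      unfolding Vector_Spaces.linear_iff using V'(1) by (simp add: V.scale_right_distrib mult.commute)
    then show "polynomial_in (cm_scale V) (\<lambda>l. cm_scale V c (snd x a l w))" for a w
      by (rule polynomial_in_linear_image[OF _ cocyclesD(7)[OF x]])
  next
    show "cm_scale V c (snd x (lca_bracket l a b) (l + m) w)
       = cm_act V a l (cm_scale V c (snd x b m w)) + cm_scale V c (snd x a l (cm_act W b m w))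
         - (cm_act V b m (cm_scale V c (snd x a l w)) + cm_scale V c (snd x b m (cm_act W a l w)))"
      for a b l m w
      by (simp add: cocyclesD(8)[OF x] V'(5) V.scale_right_distrib V.scale_right_diff_distrib)
  next
    show "cm_scale V c (snd x (lca_del a) l w)
       = cm_del V (cm_scale V c (snd x a l w)) + cm_scale V c (fst x (cm_act W a l w))
         - (cm_act V a l (cm_scale V c (fst x w)) + cm_scale V c (snd x a l (cm_del W w)))" for a l w
      by (simp add: cocyclesD(9)[OF x] V'(3,5) V.scale_right_distrib V.scale_right_diff_distrib)
  qed (simp_all add: cocyclesD(1-6)[OF x] cocyclesD(10)[OF x] V.scale_right_distrib mult.commute)
  ultimately show ?thesis
    by (rule Z.subspaceI)
qed

section \<open>Equivalence of extensions and coboundaries\<close>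

lemma ext_equiv_trans:
  assumes "ext_equiv E i p E' i' p'" "ext_equiv E' i' p' E'' i'' p''"
  shows "ext_equiv E i p E'' i'' p''"
proof -
  obtain f where f: "cm_hom E E' f" "\<And>v. f (i v) = i' v" "\<And>x. p' (f x) = p x"
    using assms(1) unfolding ext_equiv_def by blast
  obtain g where g: "cm_hom E' E'' g" "\<And>v. g (i' v) = i'' v" "\<And>x. p'' (g x) = p' x"
    using assms(2) unfolding ext_equiv_def by blast
  have "cm_hom E E'' (\<lambda>x. g (f x))"
    using f(1) g(1) unfolding cm_hom_def Vector_Spaces.linear_iff by simp
  then show ?thesis
    unfolding ext_equiv_def using f(2,3) g(2,3) by (intro exI[of _ "\<lambda>x. g (f x)"]) simp
qed

text \<open>
  The failure of a linear map \<open>\<theta>\<close> to commute with \<open>\<partial>\<close> and with the actions.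
\<close>

definition coboundary_of ::
  "'v::ab_group_add conf_mod \<Rightarrow> 'w conf_mod \<Rightarrow> ('w \<Rightarrow> 'v) \<Rightarrow> ('v, 'w) cochain" where
  "coboundary_of V W \<theta> =
     (\<lambda>w. cm_del V (\<theta> w) - \<theta> (cm_del W w), \<lambda>a l w. cm_act V a l (\<theta> w) - \<theta> (cm_act W a l w))"

text \<open>
  A linear map \<open>V \<times> W \<longrightarrow> V \<times> W\<close> that is compatible with inclusion and projection has the form
  \<open>(v, w) \<mapsto> (v + \<theta> w, w)\<close>, and it is a homomorphism exactly when the two cochains differ by the
  coboundary of \<open>\<theta>\<close>.
\<close>

lemma ext_equiv_cochain_mod_iff:
  fixes V :: "'v::ab_group_add conf_mod" and W :: "'w::ab_group_add conf_mod"
  assumes V: "conformal_module V" and W: "conformal_module W"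
  shows "ext_equiv (cochain_mod V W z) incl snd (cochain_mod V W z') incl snd \<longleftrightarrow>
    (\<exists>\<theta>. Vector_Spaces.linear (cm_scale W) (cm_scale V) \<theta> \<and> z = z' + coboundary_of V W \<theta>)"
proof
  note V' = conformal_moduleD[OF V] and W' = conformal_moduleD[OF W]
  note zero = conformal_module_zero[OF V] conformal_module_zero[OF W]
  assume "ext_equiv (cochain_mod V W z) incl snd (cochain_mod V W z') incl snd"
  then obtain \<psi> where hom: "cm_hom (cochain_mod V W z) (cochain_mod V W z') \<psi>"
    and incl: "\<And>v. \<psi> (incl v) = incl v" and snd: "\<And>x. snd (\<psi> x) = snd x"
    unfolding ext_equiv_def by blast
  define \<theta> where "\<theta> w = fst (\<psi> (0, w))" for w
  note hom' = cm_homD[OF hom, unfolded cochain_mod_simps]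
  have \<psi>: "\<psi> (v, w) = (v + \<theta> w, w)" for v w
  proof -
    have "\<psi> (v, w) = \<psi> (incl v) + \<psi> (0, w)"
      by (simp add: incl_def flip: hom'(4))
    then show ?thesis
      using snd[of "(0, w)"] unfolding incl by (simp add: incl_def \<theta>_def prod_eq_iff)
  qed
  have "Vector_Spaces.linear (cm_scale W) (cm_scale V) \<theta>"
    unfolding Vector_Spaces.linear_iff
    using V'(1) W'(1) hom'(4)[of "(0, _)" "(0, _)"] hom'(5)[of _ "(0, _)"]
    by (simp add: \<psi> zero)
  moreover have "z = z' + coboundary_of V W \<theta>"
    using hom'(6)[of "(0, _)"] hom'(7)[of _ _ "(0, _)"]
    by (auto simp: \<psi> zero coboundary_of_def prod_eq_iff fun_eq_iff algebra_simps)
  ultimately show "\<exists>\<theta>. Vector_Spaces.linear (cm_scale W) (cm_scale V) \<theta> \<and> z = z' + coboundary_of V W \<theta>"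
    by blast
next
  note V' = conformal_moduleD[OF V] and W' = conformal_moduleD[OF W]
  note vs = vector_space_prod[OF V'(1) W'(1)]
  interpret V: vector_space "cm_scale V" by (rule V'(1))
  assume "\<exists>\<theta>. Vector_Spaces.linear (cm_scale W) (cm_scale V) \<theta> \<and> z = z' + coboundary_of V W \<theta>"
  then obtain \<theta> where \<theta>: "Vector_Spaces.linear (cm_scale W) (cm_scale V) \<theta>"
    and z: "z = z' + coboundary_of V W \<theta>" by blast
  interpret \<theta>: Vector_Spaces.linear "cm_scale W" "cm_scale V" \<theta> by (rule \<theta>)
  have "cm_hom (cochain_mod V W z) (cochain_mod V W z') (\<lambda>x. (fst x + \<theta> (snd x), snd x))"
    unfolding cm_hom_def Vector_Spaces.linear_iff cochain_mod_simps
    using vs by (auto simp: z coboundary_of_def \<theta>.add \<theta>.scale V.scale_right_distrib V'(2,4) algebra_simps)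
  then show "ext_equiv (cochain_mod V W z) incl snd (cochain_mod V W z') incl snd"
    unfolding ext_equiv_def
    by (intro exI[of _ "\<lambda>x. (fst x + \<theta> (snd x), snd x)"]) (simp add: incl_def)
qed

lemma coboundaries_iff:
  assumes V: "conformal_module V" and W: "conformal_module W"
  shows "z \<in> coboundaries W V \<longleftrightarrow> z \<in> cocycles W V \<and>
    (\<exists>\<theta>. Vector_Spaces.linear (cm_scale W) (cm_scale V) \<theta> \<and> z = coboundary_of V W \<theta>)"
  using ext_equiv_cochain_mod_iff[OF V W, of z 0]
  by (simp add: coboundaries_def trivial_ext_def direct_sum_eq_cochain_mod)

lemma subspace_coboundaries:
  assumes V: "conformal_module V" and W: "conformal_module W"
  shows "module.subspace (cochain_scale V) (coboundaries W V)"
proof -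
  note V' = conformal_moduleD[OF V] and W' = conformal_moduleD[OF W]
  note zero = conformal_module_zero[OF V] conformal_module_zero[OF W]
  interpret V: vector_space "cm_scale V" by (rule V'(1))
  interpret Z: vector_space "cochain_scale V" by (rule vector_space_cochain_scale[OF V'(1)])
  note Z = subspace_cocycles[OF V W]
  let ?lin = "Vector_Spaces.linear (cm_scale W) (cm_scale V)"
  have lin: "?lin \<theta> \<longleftrightarrow> (\<forall>x y. \<theta> (x + y) = \<theta> x + \<theta> y) \<and> (\<forall>c x. \<theta> (cm_scale W c x) = cm_scale V c (\<theta> x))" for \<theta>
    unfolding Vector_Spaces.linear_iff using V'(1) W'(1) by simp
  have "?lin (\<lambda>_. 0)" "coboundary_of V W (\<lambda>_. 0) = 0"
    by (simp_all add: lin coboundary_of_def zero prod_eq_iff fun_eq_iff)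
  then have "0 \<in> coboundaries W V"
    unfolding coboundaries_iff[OF V W] using Z.subspace_0[OF Z] by metis
  moreover have "x + y \<in> coboundaries W V"
    if x: "x \<in> coboundaries W V" and y: "y \<in> coboundaries W V" for x y
  proof -
    obtain \<theta> \<theta>' where \<theta>: "?lin \<theta>" "x = coboundary_of V W \<theta>" "?lin \<theta>'" "y = coboundary_of V W \<theta>'"
      using x y unfolding coboundaries_iff[OF V W] by blast
    have "?lin (\<lambda>w. \<theta> w + \<theta>' w)"
      using \<theta> by (simp add: lin V.scale_right_distrib)
    moreover have "x + y = coboundary_of V W (\<lambda>w. \<theta> w + \<theta>' w)"
      unfolding \<theta> by (simp add: coboundary_of_def prod_eq_iff fun_eq_iff V'(2,4))
    ultimately show ?thesis
      using x y Z.subspace_add[OF Z] unfolding coboundaries_iff[OF V W] by blast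
  qed
  moreover have "cochain_scale V c x \<in> coboundaries W V" if x: "x \<in> coboundaries W V" for c x
  proof -
    obtain \<theta> where \<theta>: "?lin \<theta>" "x = coboundary_of V W \<theta>"
      using x unfolding coboundaries_iff[OF V W] by blast
    have "?lin (\<lambda>w. cm_scale V c (\<theta> w))"
      using \<theta> by (simp add: lin V.scale_right_distrib mult.commute)
    moreover have "cochain_scale V c x = coboundary_of V W (\<lambda>w. cm_scale V c (\<theta> w))"
      unfolding \<theta> by (simp add: coboundary_of_def cochain_scale_def prod_eq_iff fun_eq_iff
          V'(3,5) V.scale_right_diff_distrib)
    ultimately show ?thesis
      using x Z.subspace_scale[OF Z] unfolding coboundaries_iff[OF V W] by blast
  qed
  ultimately show ?thesis
    by (rule Z.subspaceI)
qed

lemma equivalent_cocycles_diff: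
  assumes z: "z \<in> cocycles W V" and z': "z' \<in> cocycles W V"
    and eq: "ext_equiv (cochain_mod V W z) incl snd (cochain_mod V W z') incl snd"
  shows "z - z' \<in> coboundaries W V"
proof -
  have V: "conformal_module V" and W: "conformal_module W"
    using z by (auto simp: cocycles_def is_extension_def)
  interpret Z: vector_space "cochain_scale V"
    by (rule vector_space_cochain_scale[OF conformal_moduleD(1)[OF V]])
  have "z - z' \<in> cocycles W V"
    using Z.subspace_diff[OF subspace_cocycles[OF V W]] z z' by blast
  moreover obtain \<theta> where "Vector_Spaces.linear (cm_scale W) (cm_scale V) \<theta>" "z = z' + coboundary_of V W \<theta>"
    using eq unfolding ext_equiv_cochain_mod_iff[OF V W] by blast
  ultimately show ?thesis
    unfolding coboundaries_iff[OF V W] by auto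
qed

section \<open>Extensions with a linear section\<close>

text \<open>
  The bijection \<open>(v, w) \<mapsto> i v + \<sigma> w\<close> carries the structure of \<open>E\<close> back to \<open>V \<times> W\<close>. The resulting
  corrections measure how far \<open>\<sigma>\<close> is from being a homomorphism; in particular the correction to
  \<open>\<partial>\<close> vanishes when \<open>\<sigma>\<close> commutes with \<open>\<partial>\<close>.
\<close>

lemma extension_with_linear_section:
  fixes V :: "'v::ab_group_add conf_mod" and W :: "'w::ab_group_add conf_mod"
    and E :: "'e::ab_group_add conf_mod"
  assumes ext: "is_extension V W E i p"
    and \<sigma>: "Vector_Spaces.linear (cm_scale W) (cm_scale E) \<sigma>" and p\<sigma>: "\<And>w. p (\<sigma> w) = w"
  obtains z where "z \<in> cocycles W V" "ext_equiv E i p (cochain_mod V W z) incl snd"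
    "\<And>w. i (fst z w) = cm_del E (\<sigma> w) - \<sigma> (cm_del W w)"
proof -
  have V: "conformal_module V" and W: "conformal_module W" and E: "conformal_module E"
    and i: "cm_hom V E i" and p: "cm_hom E W p"
    and inj_i: "inj i" and range_i: "range i = {x. p x = 0}"
    using ext by (auto simp: is_extension_def)
  note V' = conformal_moduleD[OF V] and W' = conformal_moduleD[OF W] and E' = conformal_moduleD[OF E]
  note i' = cm_homD[OF i] and p' = cm_homD[OF p]
  note vs = vector_space_prod[OF V'(1) W'(1)]
  interpret E: vector_space "cm_scale E" by (rule E'(1))
  interpret \<sigma>: Vector_Spaces.linear "cm_scale W" "cm_scale E" \<sigma> by (rule \<sigma>)
  have ij: "i (inv i x) = x" if "p x = 0" for x
    using that range_i by (intro f_inv_into_f) simp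
  have pi: "p (i v) = 0" for v
    using range_i by blast
  define z where "z = (\<lambda>w. inv i (cm_del E (\<sigma> w) - \<sigma> (cm_del W w)),
    \<lambda>a l w. inv i (cm_act E a l (\<sigma> w) - \<sigma> (cm_act W a l w)))"
  have i1: "i (fst z w) = cm_del E (\<sigma> w) - \<sigma> (cm_del W w)" for w
    unfolding z_def fst_conv by (rule ij) (simp add: cm_hom_minus[OF p] p' p\<sigma>)
  have i2: "i (snd z a l w) = cm_act E a l (\<sigma> w) - \<sigma> (cm_act W a l w)" for a l w
    unfolding z_def snd_conv by (rule ij) (simp add: cm_hom_minus[OF p] p' p\<sigma>)
  define \<Psi> where "\<Psi> x = i (fst x) + \<sigma> (snd x)" for x
  have hom: "cm_hom (cochain_mod V W z) E \<Psi>"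
    unfolding cm_hom_def Vector_Spaces.linear_iff cochain_mod_simps
    using vs E'(1)
    by (auto simp: \<Psi>_def i'(4-7) i1 i2 \<sigma>.add \<sigma>.scale E.scale_right_distrib E'(2,4) algebra_simps)
  have "bij \<Psi>"
  proof (rule bijI)
    show "inj \<Psi>"
    proof (rule injI)
      fix x y assume eq: "\<Psi> x = \<Psi> y"
      then have "p (\<Psi> x) = p (\<Psi> y)" by simp
      then have "snd x = snd y" by (simp add: \<Psi>_def p'(4) pi p\<sigma>)
      with eq inj_i show "x = y" by (simp add: \<Psi>_def prod_eq_iff inj_def)
    qed
    show "surj \<Psi>"
    proof (rule surjI)
      fix x
      have "i (inv i (x - \<sigma> (p x))) = x - \<sigma> (p x)"
        by (rule ij) (simp add: cm_hom_minus[OF p] p\<sigma>)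
      then show "\<Psi> (inv i (x - \<sigma> (p x)), p x) = x"
        by (simp add: \<Psi>_def)
    qed
  qed
  have Z: "conformal_module (cochain_mod V W z)"
    by (rule conformal_module_transport[OF hom \<open>bij \<Psi>\<close> E])
  have \<Psi>_incl: "\<Psi> (incl v) = i v" for v
    by (simp add: \<Psi>_def incl_def \<sigma>.zero)
  have p\<Psi>: "p (\<Psi> x) = snd x" for x
    by (simp add: \<Psi>_def p'(4) pi p\<sigma>)
  have inv_hom: "cm_hom E (cochain_mod V W z) (inv \<Psi>)"
    by (rule cm_hom_inv[OF hom \<open>bij \<Psi>\<close>])
  have "ext_equiv E i p (cochain_mod V W z) incl snd"
    unfolding ext_equiv_def
    using inv_hom \<open>bij \<Psi>\<close> \<Psi>_incl p\<Psi>
    by (intro exI[of _ "inv \<Psi>"]) (metis bij_inv_eq_iff)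
  moreover have "z \<in> cocycles W V"
    using Z by (simp add: cocycles_iff_conformal_module[OF V W])
  ultimately show thesis using i1 that by blast
qed

section \<open>The modules of rank one and of dimension one\<close>

lemma conformal_module_mod_C: "conformal_module (mod_C \<gamma>)"
  unfolding conformal_module_iff mod_C_def conf_mod.simps polynomial_in_complex_iff
  by (intro conjI allI; (rule vector_space_times exI[of _ 0])?; simp add: algebra_simps)

text \<open>
  Both factors of the action on \<open>V(\<alpha>, \<Delta>)\<close>, the scalar \<open>p(-\<lambda>)\<close> and the shifted polynomial
  \<open>h(\<partial> + \<lambda>)\<close>, are values of polynomials over \<open>\<complex>[\<partial>]\<close>.
\<close>

lemma pcompose_shift_bivariate:
  fixes h :: "complex poly"
  shows "\<exists>G. \<forall>l. pcompose h [:l, 1:] = poly G [:l:]"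
proof (induction h)
  case 0
  show ?case by (rule exI[of _ 0]) simp
next
  case (pCons a h)
  then obtain G where G: "\<And>l. pcompose h [:l, 1:] = poly G [:l:]" by blast
  have "pcompose (pCons a h) [:l, 1:] = poly ([:[:a:]:] + [:[:0, 1:], 1:] * G) [:l:]" for l
    unfolding pcompose_pCons G by (simp add: algebra_simps)
  then show ?case by (intro exI allI)
qed

lemma poly_value_bivariate:
  fixes q :: "complex poly"
  shows "\<exists>G. \<forall>l. [:poly q l:] = poly G [:l:]"
proof (induction q)
  case 0
  show ?case by (rule exI[of _ 0]) simp
next
  case (pCons a q)
  then obtain G where G: "\<And>l. [:poly q l:] = poly G [:l:]" by blast
  have "[:poly (pCons a q) l:] = [:a:] + [:l:] * [:poly q l:]" for l
    by simp
  then have "[:poly (pCons a q) l:] = poly ([:[:a:]:] + [:0, 1:] * G) [:l:]" for l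
    unfolding G by simp
  then show ?case by (intro exI allI)
qed

lemma conformal_module_mod_V: "conformal_module (mod_V \<alpha> \<Delta>)"
proof -
  have poly: "polynomial_in smult (\<lambda>l. smult (poly q (- l)) (poly_shift l h * [:\<alpha> + \<Delta> * l, 1:]))" for q h
  proof -
    obtain G where G: "\<And>l. pcompose h [:l, 1:] = poly G [:l:]"
      using pcompose_shift_bivariate[of h] by blast
    obtain Q where Q: "\<And>l. [:poly (pcompose q [:0, -1:]) l:] = poly Q [:l:]"
      using poly_value_bivariate[of "pcompose q [:0, -1:]"] by blast
    show ?thesis
    proof (rule polynomial_in_smult_if_bivariate)
      fix l
      have "smult (poly q (- l)) (poly_shift l h * [:\<alpha> + \<Delta> * l, 1:])
          = [:poly (pcompose q [:0, -1:]) l:] * (pcompose h [:l, 1:] * [:\<alpha> + \<Delta> * l, 1:])"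
        by (simp add: poly_shift_def poly_pcompose)
      also have "\<dots> = poly (Q * (G * [:[:\<alpha>, 1:], [:\<Delta>:]:])) [:l:]"
        unfolding G Q by (simp add: algebra_simps smult_add_left)
      finally show "smult (poly q (- l)) (poly_shift l h * [:\<alpha> + \<Delta> * l, 1:])
        = poly (Q * (G * [:[:\<alpha>, 1:], [:\<Delta>:]:])) [:l:]" .
    qed
  qed
  show ?thesis
    unfolding conformal_module_iff mod_V_def conf_mod.simps
    by (intro conjI allI;
        (rule vector_space_smult poly
        | (rule poly_ext, simp add: poly_shift_def poly_pcompose lca_scale_def lca_del_def
             lca_bracket_def algebra_simps)))
qed

section \<open>Extensions of the rank one module by the one-dimensional one\<close>

lemma mod_V_simps [simp]:
  "cm_scale (mod_V \<alpha> \<Delta>) = smult"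
  "cm_del (mod_V \<alpha> \<Delta>) = (\<lambda>h. [:0, 1:] * h)"
  "cm_act (mod_V \<alpha> \<Delta>) = (\<lambda>a l h. smult (poly (fst a) (- l)) (poly_shift l h * [:\<alpha> + \<Delta> * l, 1:]))"
  by (simp_all add: mod_V_def)

lemma mod_C_simps [simp]:
  "cm_scale (mod_C \<gamma>) = (*)" "cm_del (mod_C \<gamma>) = (*) \<gamma>" "cm_act (mod_C \<gamma>) = (\<lambda>a l c. 0)"
  by (simp_all add: mod_C_def)

text \<open>The corrections that turn the direct sum into \<open>mod_E\<close>.\<close>

definition E_cocycle :: "complex \<Rightarrow> complex poly \<Rightarrow> complex poly \<Rightarrow> (complex, complex poly) cochain" where
  "E_cocycle \<gamma> f g = (\<lambda>_. 0, \<lambda>a l h.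
     poly h (\<gamma> + l) * (poly (fst a) (- l) * poly f l + poly (snd a) (- l) * poly g l))"

lemma mod_E_eq_cochain_mod: "mod_E \<alpha> \<gamma> \<Delta> f g = cochain_mod (mod_C \<gamma>) (mod_V \<alpha> \<Delta>) (E_cocycle \<gamma> f g)"
  by (simp add: mod_E_def cochain_mod_def E_cocycle_def)

lemma direct_sum_eq_mod_E: "direct_sum (mod_C \<gamma>) (mod_V \<alpha> \<Delta>) = mod_E \<alpha> \<gamma> \<Delta> 0 0"
  by (simp add: mod_E_def direct_sum_def)

text \<open>
  Only the commutator relation is not automatic. By sesquilinearity it suffices to have it for
  the generators: the pair \<open>(L, L)\<close> gives the first equation, \<open>(I, L)\<close> and \<open>(L, I)\<close> both give the
  second, and for \<open>(I, I)\<close> both sides vanish.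
\<close>

lemma E_cocycle_in_cocycles_iff:
  "E_cocycle \<gamma> f g \<in> cocycles (mod_V \<alpha> \<Delta>) (mod_C \<gamma>) \<longleftrightarrow>
    (\<forall>l m. (\<alpha> + \<gamma> + l + \<Delta> * m) * poly f l - (\<alpha> + \<gamma> + m + \<Delta> * l) * poly f m
         = (l - m) * (poly f (l + m) + poly g (l + m))) \<and>
    (\<forall>l m. (\<alpha> + \<gamma> + m + \<Delta> * l) * poly g m = m * poly g (l + m))" (is "?Z \<longleftrightarrow> ?LL \<and> ?IL")
proof
  assume Z: ?Z
  note Jacobi = cocyclesD(8)[OF Z]
  have "(\<alpha> + \<gamma> + l + \<Delta> * m) * poly f l - (\<alpha> + \<gamma> + m + \<Delta> * l) * poly f m
         = (l - m) * (poly f (l + m) + poly g (l + m))" for l m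
    using Jacobi[of l gen_L gen_L m 1]
    by (simp add: E_cocycle_def gen_L_def lca_bracket_def poly_shift_def poly_pcompose algebra_simps)
  moreover have "(\<alpha> + \<gamma> + m + \<Delta> * l) * poly g m = m * poly g (l + m)" for l m
    using Jacobi[of m gen_I gen_L l 1]
    by (simp add: E_cocycle_def gen_L_def gen_I_def lca_bracket_def poly_shift_def poly_pcompose algebra_simps)
  ultimately show "?LL \<and> ?IL" by blast
next
  assume "?LL \<and> ?IL"
  then have LL: "\<And>l m. (\<alpha> + \<gamma> + l + \<Delta> * m) * poly f l - (\<alpha> + \<gamma> + m + \<Delta> * l) * poly f m
         = (l - m) * (poly f (l + m) + poly g (l + m))"
    and IL: "\<And>l m. (\<alpha> + \<gamma> + m + \<Delta> * l) * poly g m = m * poly g (l + m)"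
    by blast+
  have poly: "polynomial_in (*) (\<lambda>l. poly h (\<gamma> + l) * (poly p (- l) * poly f l + poly q (- l) * poly g l))" for h p q
    unfolding polynomial_in_complex_iff
    by (rule exI[of _ "pcompose h [:\<gamma>, 1:] * (pcompose p [:0, -1:] * f + pcompose q [:0, -1:] * g)"])
      (simp add: poly_pcompose)
  have Jacobi: "poly w (\<gamma> + (l + m)) *
      (poly (fst (lca_bracket l a b)) (- (l + m)) * poly f (l + m)
       + poly (snd (lca_bracket l a b)) (- (l + m)) * poly g (l + m))
    = poly (smult (poly (fst b) (- m)) (poly_shift m w * [:\<alpha> + \<Delta> * m, 1:])) (\<gamma> + l)
        * (poly (fst a) (- l) * poly f l + poly (snd a) (- l) * poly g l)
      - poly (smult (poly (fst a) (- l)) (poly_shift l w * [:\<alpha> + \<Delta> * l, 1:])) (\<gamma> + m)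
        * (poly (fst b) (- m) * poly f m + poly (snd b) (- m) * poly g m)" (is "?lhs = ?rhs") for a b l m w
  proof -
    \<comment> \<open>Abstracting the values of the polynomials leaves an identity that is linear in the two equations.\<close>
    define H p q p' q' where H: "H = poly w (\<gamma> + l + m)"
      and pq: "p = poly (fst a) (- l)" "q = poly (snd a) (- l)"
        "p' = poly (fst b) (- m)" "q' = poly (snd b) (- m)"
    have H': "poly w (\<gamma> + (l + m)) = H" "poly w (l + (\<gamma> + m)) = H" "poly w (m + (\<gamma> + l)) = H"
      by (simp_all add: H algebra_simps)
    have b: "poly (fst b) (l + - (l + m)) = p'" "poly (snd b) (l + - (l + m)) = q'"
      by (simp_all add: pq)
    have "?lhs = H * (p * p' * ((l - m) * (poly f (l + m) + poly g (l + m)))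
        - p * q' * (m * poly g (l + m)) + q * p' * (l * poly g (m + l)))"
      by (simp add: H' lca_bracket_def poly_shift_def poly_pcompose b algebra_simps flip: pq)
    also have "\<dots> = ?rhs"
      unfolding LL[symmetric] IL[symmetric]
      by (simp add: H' poly_shift_def poly_pcompose algebra_simps flip: pq)
    finally show ?thesis .
  qed
  show ?Z
  proof (rule cocyclesI[OF conformal_module_mod_C conformal_module_mod_V];
      unfold E_cocycle_def fst_conv snd_conv mod_V_simps mod_C_simps)
    show "poly h (\<gamma> + (l + m)) *
      (poly (fst (lca_bracket l a b)) (- (l + m)) * poly f (l + m)
       + poly (snd (lca_bracket l a b)) (- (l + m)) * poly g (l + m))
      = 0 + poly (smult (poly (fst b) (- m)) (poly_shift m h * [:\<alpha> + \<Delta> * m, 1:])) (\<gamma> + l)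
        * (poly (fst a) (- l) * poly f l + poly (snd a) (- l) * poly g l)
      - (0 + poly (smult (poly (fst a) (- l)) (poly_shift l h * [:\<alpha> + \<Delta> * l, 1:])) (\<gamma> + m)
        * (poly (fst b) (- m) * poly f m + poly (snd b) (- m) * poly g m))" for a b l m h
      using Jacobi by simp
  qed (rule poly | simp add: lca_scale_def lca_del_def algebra_simps)+
qed

text \<open>
  If \<open>\<partial>\<close> is not corrected, then sesquilinearity determines the correction to \<open>a\<^sub>\<lambda> h(\<partial>)v\<^sub>\<Delta>\<close> from
  its values at \<open>v\<^sub>\<Delta>\<close> for \<open>a = L\<close> and \<open>a = I\<close>. On \<open>h\<close> and on the coefficients of \<open>a\<close> this is the
  uniqueness of linear maps out of \<open>\<complex>[\<partial>]\<close>, with \<open>\<partial>\<close> acting on the target as \<open>\<gamma> + \<lambda>\<close> and as \<open>-\<lambda>\<close>.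
\<close>

lemma cocycle_without_del_term:
  assumes Z: "z \<in> cocycles (mod_V \<alpha> \<Delta>) (mod_C \<gamma>)" and d: "\<And>h. fst z h = 0"
  obtains f g where "z = E_cocycle \<gamma> f g"
proof -
  note D = cocyclesD[OF Z, unfolded mod_V_simps mod_C_simps]
  have del_h: "snd z a l ([:0, 1:] * h) = (\<gamma> + l) * snd z a l h" for a l h
    using D(9)[of a l h] D(10)[of a l h] d by (simp add: algebra_simps)
  have h: "snd z a l h = poly h (\<gamma> + l) * snd z a l 1" for a l h
  proof (rule poly_linear_map_ext[where s = "(*)" and D = "(*) (\<gamma> + l)"
        and \<sigma> = "snd z a l" and \<tau> = "\<lambda>h. poly h (\<gamma> + l) * snd z a l 1"])
    show "Vector_Spaces.linear smult (*) (snd z a l)"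
      "Vector_Spaces.linear smult (*) (\<lambda>h. poly h (\<gamma> + l) * snd z a l 1)"
      unfolding Vector_Spaces.linear_iff
      by (simp_all add: D(3,4) vector_space_smult vector_space_times algebra_simps)
  qed (simp_all add: del_h[simplified])
  have L: "snd z (p, 0) l 1 = poly p (- l) * snd z gen_L l 1" for p l
  proof (rule poly_linear_map_ext[where s = "(*)" and D = "(*) (- l)"
        and \<sigma> = "\<lambda>p. snd z (p, 0) l 1" and \<tau> = "\<lambda>p. poly p (- l) * snd z gen_L l 1"])
    have "snd z (p + q, 0) l 1 = snd z (p, 0) l 1 + snd z (q, 0) l 1"
      "snd z (smult c p, 0) l 1 = c * snd z (p, 0) l 1" for p q c
      using D(5)[of "(p, 0)" "(q, 0)" l 1] D(6)[of c "(p, 0)" l 1] by (simp_all add: lca_scale_def)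
    then show "Vector_Spaces.linear smult (*) (\<lambda>p. snd z (p, 0) l 1)"
      "Vector_Spaces.linear smult (*) (\<lambda>p. poly p (- l) * snd z gen_L l 1)"
      unfolding Vector_Spaces.linear_iff
      by (simp_all add: vector_space_smult vector_space_times algebra_simps)
    show "snd z ([:0, 1:] * h, 0) l 1 = - l * snd z (h, 0) l 1" for h
      using D(10)[of "(h, 0)" l 1] by (simp add: lca_del_def)
  qed (simp_all add: gen_L_def)
  have I: "snd z (0, p) l 1 = poly p (- l) * snd z gen_I l 1" for p l
  proof (rule poly_linear_map_ext[where s = "(*)" and D = "(*) (- l)"
        and \<sigma> = "\<lambda>p. snd z (0, p) l 1" and \<tau> = "\<lambda>p. poly p (- l) * snd z gen_I l 1"])
    have "snd z (0, p + q) l 1 = snd z (0, p) l 1 + snd z (0, q) l 1"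
      "snd z (0, smult c p) l 1 = c * snd z (0, p) l 1" for p q c
      using D(5)[of "(0, p)" "(0, q)" l 1] D(6)[of c "(0, p)" l 1] by (simp_all add: lca_scale_def)
    then show "Vector_Spaces.linear smult (*) (\<lambda>p. snd z (0, p) l 1)"
      "Vector_Spaces.linear smult (*) (\<lambda>p. poly p (- l) * snd z gen_I l 1)"
      unfolding Vector_Spaces.linear_iff
      by (simp_all add: vector_space_smult vector_space_times algebra_simps)
    show "snd z (0, [:0, 1:] * h) l 1 = - l * snd z (0, h) l 1" for h
      using D(10)[of "(0, h)" l 1] by (simp add: lca_del_def)
  qed (simp_all add: gen_I_def)
  obtain f g where f: "\<And>l. snd z gen_L l 1 = poly f l" and g: "\<And>l. snd z gen_I l 1 = poly g l"
    using D(7)[of gen_L 1] D(7)[of gen_I 1] unfolding polynomial_in_complex_iff by blast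
  have z1: "snd z a l 1 = poly (fst a) (- l) * poly f l + poly (snd a) (- l) * poly g l" for a l
    using D(5)[of "(fst a, 0)" "(0, snd a)" l 1] L[of "fst a" l] I[of "snd a" l] by (simp add: f g)
  have "fst z w = fst (E_cocycle \<gamma> f g) w" "snd z a l w = snd (E_cocycle \<gamma> f g) a l w" for a l w
    using h[of a l w] by (simp_all add: E_cocycle_def d z1)
  then have "z = E_cocycle \<gamma> f g"
    by (intro prod_eqI ext)
  then show thesis by (rule that)
qed

text \<open>
  Freeness of \<open>V(\<alpha>, \<Delta>)\<close> over \<open>\<complex>[\<partial>]\<close> provides a section that commutes with \<open>\<partial>\<close>.
\<close>

lemma extension_equiv_mod_E:
  assumes ext: "is_extension (mod_C \<gamma>) (mod_V \<alpha> \<Delta>) E i p"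
  obtains f g where "E_cocycle \<gamma> f g \<in> cocycles (mod_V \<alpha> \<Delta>) (mod_C \<gamma>)"
    "ext_equiv E i p (mod_E \<alpha> \<gamma> \<Delta> f g) incl snd"
proof -
  have E: "conformal_module E" and p: "cm_hom E (mod_V \<alpha> \<Delta>) p"
    and i: "cm_hom (mod_C \<gamma>) E i" and "inj i" and "surj p"
    using ext by (auto simp: is_extension_def)
  note p' = cm_homD[OF p, unfolded mod_V_simps]
  obtain e where e: "p e = 1"
    using \<open>surj p\<close> by (metis surjD)
  have "Vector_Spaces.linear (cm_scale E) (cm_scale E) (cm_del E)"
    using E by (simp add: conformal_module_def)
  from poly_linear_map_exists[OF this, of e] obtain \<sigma>
    where \<sigma>: "Vector_Spaces.linear smult (cm_scale E) \<sigma>" "\<sigma> 1 = e"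
      "\<And>h. \<sigma> ([:0, 1:] * h) = cm_del E (\<sigma> h)" by blast
  have p\<sigma>: "p (\<sigma> h) = h" for h
  proof (rule poly_linear_map_ext[where s = smult and D = "(*) [:0, 1:]"
        and \<sigma> = "\<lambda>h. p (\<sigma> h)" and \<tau> = "\<lambda>h. h"])
    show "Vector_Spaces.linear smult smult (\<lambda>h. p (\<sigma> h))"
      using Vector_Spaces.linear_compose[OF \<sigma>(1) p'(1)] by (simp add: o_def)
    show "p (\<sigma> ([:0, 1:] * h)) = [:0, 1:] * p (\<sigma> h)" for h
      unfolding \<sigma>(3) p'(6) ..
    show "p (\<sigma> 1) = 1" unfolding \<sigma>(2) by (rule e)
    show "Vector_Spaces.linear smult smult (\<lambda>h::complex poly. h)"
      unfolding Vector_Spaces.linear_iff by (simp add: vector_space_smult)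
  qed (rule refl)
  from extension_with_linear_section[OF ext, unfolded mod_V_simps, OF \<sigma>(1) p\<sigma>]
  obtain z where z: "z \<in> cocycles (mod_V \<alpha> \<Delta>) (mod_C \<gamma>)"
    "ext_equiv E i p (cochain_mod (mod_C \<gamma>) (mod_V \<alpha> \<Delta>) z) incl snd"
    "\<And>w. i (fst z w) = cm_del E (\<sigma> w) - \<sigma> ([:0, 1:] * w)" by blast
  have "i 0 = 0"
    using cm_homD(4)[OF i, of 0 0] by simp
  then have "fst z w = 0" for w
    using z(3)[of w] \<open>inj i\<close> unfolding \<sigma>(3) by (simp add: inj_def)
  from cocycle_without_del_term[OF z(1) this] obtain f g where "z = E_cocycle \<gamma> f g" .
  with z show thesis
    using that by (simp add: mod_E_eq_cochain_mod)
qed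

text \<open>
  A linear map \<open>\<theta>: \<complex>[\<partial>]v\<^sub>\<Delta> \<longrightarrow> \<complex>c\<^sub>\<gamma>\<close> whose coboundary does not correct \<open>\<partial>\<close> is a multiple of the
  evaluation \<open>h \<mapsto> h(\<gamma>)\<close>; applied to \<open>L\<^sub>\<lambda> v\<^sub>\<Delta> = (\<partial> + \<alpha> + \<Delta>\<lambda>) v\<^sub>\<Delta>\<close> it gives the polynomial
  \<open>\<alpha> + \<gamma> + \<Delta>\<lambda>\<close>.
\<close>

lemma ext_equiv_mod_E_iff:
  "ext_equiv (mod_E \<alpha> \<gamma> \<Delta> f g) incl snd (mod_E \<alpha> \<gamma> \<Delta> f' g') incl snd \<longleftrightarrow>
    g = g' \<and> (\<exists>b. f = f' + smult b [:\<alpha> + \<gamma>, \<Delta>:])"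
  unfolding mod_E_eq_cochain_mod ext_equiv_cochain_mod_iff[OF conformal_module_mod_C conformal_module_mod_V]
    mod_V_simps mod_C_simps
proof
  assume "\<exists>\<theta>. Vector_Spaces.linear smult (*) \<theta> \<and>
    E_cocycle \<gamma> f g = E_cocycle \<gamma> f' g' + coboundary_of (mod_C \<gamma>) (mod_V \<alpha> \<Delta>) \<theta>"
  then obtain \<theta> where \<theta>: "Vector_Spaces.linear smult (*) \<theta>"
    and eq: "E_cocycle \<gamma> f g = E_cocycle \<gamma> f' g' + coboundary_of (mod_C \<gamma>) (mod_V \<alpha> \<Delta>) \<theta>"
    by blast
  have add: "\<theta> (x + y) = \<theta> x + \<theta> y" and scale: "\<theta> (smult c x) = c * \<theta> x" for c x y
    using \<theta> unfolding Vector_Spaces.linear_iff by blast+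
  have fst_eq: "fst (E_cocycle \<gamma> f g) w = fst (E_cocycle \<gamma> f' g') w + (\<gamma> * \<theta> w - \<theta> ([:0, 1:] * w))" for w
    unfolding eq by (simp add: coboundary_of_def)
  have snd_eq: "snd (E_cocycle \<gamma> f g) a l w = snd (E_cocycle \<gamma> f' g') a l w
      - \<theta> (smult (poly (fst a) (- l)) (poly_shift l w * [:\<alpha> + \<Delta> * l, 1:]))" for a l w
    unfolding eq by (simp add: coboundary_of_def)
  have del1: "\<theta> [:0, 1:] = \<gamma> * \<theta> 1"
    using fst_eq[of 1] by (simp add: E_cocycle_def)
  have \<theta>_action: "\<theta> [:\<alpha> + \<Delta> * l, 1:] = (\<alpha> + \<gamma> + \<Delta> * l) * \<theta> 1" for l
  proof -
    have "[:\<alpha> + \<Delta> * l, 1:] = smult (\<alpha> + \<Delta> * l) 1 + [:0, 1:]"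
      by (simp add: one_pCons)
    then have "\<theta> [:\<alpha> + \<Delta> * l, 1:] = (\<alpha> + \<Delta> * l) * \<theta> 1 + \<theta> [:0, 1:]"
      by (simp only: add scale)
    then show ?thesis
      unfolding del1 by (simp add: algebra_simps)
  qed
  have f_eq: "poly f l = poly f' l - (\<alpha> + \<gamma> + \<Delta> * l) * \<theta> 1" for l
    using snd_eq[of gen_L l 1] by (simp add: E_cocycle_def gen_L_def poly_shift_def pcompose_1 \<theta>_action[simplified])
  have "poly f l = poly (f' + smult (- \<theta> 1) [:\<alpha> + \<gamma>, \<Delta>:]) l" for l
    using f_eq[of l] by (simp add: algebra_simps)
  then have "f = f' + smult (- \<theta> 1) [:\<alpha> + \<gamma>, \<Delta>:]"
    by (rule poly_ext)
  moreover have "poly g l = poly g' l" for l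
    using snd_eq[of gen_I l 1] add[of 0 0] by (simp add: E_cocycle_def gen_I_def)
  then have "g = g'"
    by (rule poly_ext)
  ultimately show "g = g' \<and> (\<exists>b. f = f' + smult b [:\<alpha> + \<gamma>, \<Delta>:])"
    by blast
next
  assume "g = g' \<and> (\<exists>b. f = f' + smult b [:\<alpha> + \<gamma>, \<Delta>:])"
  then obtain b where g: "g = g'" and f: "f = f' + smult b [:\<alpha> + \<gamma>, \<Delta>:]" by blast
  let ?\<theta> = "\<lambda>h. - b * poly h \<gamma>"
  have "Vector_Spaces.linear smult (*) ?\<theta>"
    unfolding Vector_Spaces.linear_iff
    by (simp add: vector_space_smult vector_space_times algebra_simps)
  moreover have "E_cocycle \<gamma> f g = E_cocycle \<gamma> f' g' + coboundary_of (mod_C \<gamma>) (mod_V \<alpha> \<Delta>) ?\<theta>"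
    unfolding f g
    by (simp add: E_cocycle_def coboundary_of_def prod_eq_iff fun_eq_iff poly_shift_def
        poly_pcompose algebra_simps)
  ultimately show "\<exists>\<theta>. Vector_Spaces.linear smult (*) \<theta> \<and>
    E_cocycle \<gamma> f g = E_cocycle \<gamma> f' g' + coboundary_of (mod_C \<gamma>) (mod_V \<alpha> \<Delta>) \<theta>"
    by blast
qed

section \<open>The functional equations\<close>

lemma power3_gt: "4 \<le> n \<Longrightarrow> (n + 1) * 2 ^ n < (3::nat) ^ n"
proof (induction n rule: dec_induct)
  case base
  then show ?case by simp
next
  case (step n)
  have "(Suc n + 1) * 2 ^ Suc n \<le> 3 * ((n + 1) * 2 ^ n)" 
    using step(1) by (simp add: algebra_simps)
  also have "\<dots> < 3 ^ Suc n" using step by simp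
  finally show ?case .
qed

text \<open>
  Evaluation at \<open>\<mu> = 0\<close> gives \<open>g(0) = 0\<close>, and \<open>\<mu> = 1\<close> expresses all values of \<open>g\<close> through \<open>g(1)\<close>
  by an affine function. Its vanishing at \<open>0\<close> and its value at \<open>1\<close> yield the conditions on \<open>s\<close>
  and \<open>\<Delta>\<close>.
\<close>

lemma I_cocycle_eq_imp:
  fixes g :: "complex \<Rightarrow> complex"
  assumes "\<Delta> \<noteq> 0"
    and eq: "\<And>l m. (s + m + \<Delta> * l) * g m = m * g (l + m)"
  shows "g x = x * g 1" and "g 1 = 0 \<or> s = 0 \<and> \<Delta> = 1"
proof -
  have g0: "g 0 = 0"
  proof -
    have "(s + \<Delta> * l) * g 0 = 0" for l
      using eq[of 0 l] by simp
    from this[of 0] this[of 1] show ?thesis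
      using assms(1) by auto
  qed
  have s: "s = 0 \<or> g 1 = 0"
    using eq[of 1 0] by (auto simp: algebra_simps)
  have aff: "g (l + 1) = (s + 1 + \<Delta> * l) * g 1" for l
    using eq[of 1 l] by simp
  have D: "(1 + s - \<Delta>) * g 1 = 0"
    using aff[of "-1"] g0 by (simp add: algebra_simps)
  show 1: "g 1 = 0 \<or> s = 0 \<and> \<Delta> = 1"
    using s D by auto
  show "g x = x * g 1"
    using aff[of "x - 1"] 1 by auto
qed

text \<open>
  The \<open>\<mu>\<close>-derivative at \<open>\<mu> = 0\<close> of the equation for \<open>f\<close>. The Euler operator \<open>\<lambda> d/d\<lambda>\<close> on the right
  acts on \<open>\<lambda>\<^sup>n\<close> as multiplication by \<open>n\<close>.
\<close>

lemma L_cocycle_derivative: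
  fixes f :: "complex poly"
  assumes eq: "\<And>l m. (l + \<Delta> * m) * poly f l - (m + \<Delta> * l) * poly f m = (l - m) * poly f (l + m)"
    and f0: "poly f 0 = 0"
  shows "smult (\<Delta> + 1) f = [:0, 1:] * pderiv f + [:0, \<Delta> * coeff f 1:]"
proof -
  have f1: "poly (pderiv f) 0 = coeff f 1"
    by (simp add: poly_0_coeff_0 coeff_pderiv)
  have "(\<Delta> + 1) * poly f l = l * poly (pderiv f) l + \<Delta> * coeff f 1 * l" for l
  proof -
    \<comment> \<open>Both sides of the equation for fixed \<open>\<lambda>\<close>, as polynomials in \<open>\<mu>\<close>.\<close>
    let ?P = "[:l, \<Delta>:] * [:poly f l:] - [:\<Delta> * l, 1:] * f"
    let ?Q = "[:l, -1:] * pcompose f [:l, 1:]"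
    have "poly ?P m = poly ?Q m" for m
      using eq[of l m] by (simp add: poly_pcompose algebra_simps)
    then have "?P = ?Q"
      by (rule poly_ext)
    then have "poly (pderiv ?P) 0 = poly (pderiv ?Q) 0"
      by simp
    moreover have "poly (pderiv ?P) 0 = \<Delta> * poly f l - \<Delta> * l * coeff f 1 - poly f 0"
      unfolding pderiv_mult pderiv_diff using f1 by (simp add: pderiv_pCons)
    moreover have "poly (pderiv ?Q) 0 = l * poly (pderiv f) l - poly f l"
      unfolding pderiv_mult pderiv_pcompose by (simp add: pderiv_pCons poly_pcompose)
    ultimately have "\<Delta> * poly f l - \<Delta> * l * coeff f 1 - poly f 0 = l * poly (pderiv f) l - poly f l"
      by (simp only:)
    then show ?thesis
      using f0 by (simp add: algebra_simps)
  qed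
  then show ?thesis
    by (intro poly_ext) (simp add: algebra_simps)
qed

text \<open>
  At \<open>\<lambda> = 2\<close>, \<open>\<mu> = 1\<close> the equation becomes \<open>(n + 1) 2\<^sup>n + 1 = 3\<^sup>n + 2 n\<close>, which is false for
  \<open>n \<ge> 4\<close> since \<open>3\<^sup>n\<close> exceeds \<open>(n + 1) 2\<^sup>n\<close>.
\<close>

lemma monom_L_cocycle:
  assumes "2 \<le> n" "c \<noteq> 0" "\<Delta> = of_nat n - (1::complex)"
    and eq: "\<And>l m. (l + \<Delta> * m) * (c * l ^ n) - (m + \<Delta> * l) * (c * m ^ n) = (l - m) * (c * (l + m) ^ n)"
  shows "n = 2 \<or> n = 3"
proof (rule ccontr)
  assume "\<not> (n = 2 \<or> n = 3)"
  then have n: "4 \<le> n" using assms(1) by simp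
  have "c * ((2 + \<Delta>) * 2 ^ n) = c * (3 ^ n + (1 + 2 * \<Delta>))"
    using eq[of 2 1] by (simp add: algebra_simps)
  then have "(2 + \<Delta>) * 2 ^ n = 3 ^ n + (1 + 2 * \<Delta>)"
    using assms(2) by simp
  then have "of_nat ((n + 1) * 2 ^ n + 1) = (of_nat (3 ^ n + 2 * n) :: complex)"
    by (simp add: assms(3) algebra_simps)
  then have "(n + 1) * 2 ^ n + 1 = 3 ^ n + 2 * n"
    by (simp only: of_nat_eq_iff)
  with power3_gt[OF n] n show False by linarith
qed

text \<open>
  For \<open>s \<noteq> 0\<close> the value at \<open>\<mu> = 0\<close> exhibits \<open>f\<close> as a coboundary. For \<open>s = 0\<close> it gives
  \<open>f(0) = 0\<close>; after subtracting the linear term, which is a coboundary, the Euler equation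
  leaves at most the monomial of degree \<open>\<Delta> + 1\<close>.
\<close>

lemma L_cocycle_eq_cases:
  fixes f :: "complex poly"
  assumes "\<Delta> \<noteq> 0"
    and eq: "\<And>l m. (s + l + \<Delta> * m) * poly f l - (s + m + \<Delta> * l) * poly f m
                    = (l - m) * poly f (l + m)"
  obtains (coboundary) b where "f = smult b [:s, \<Delta>:]"
  | (monomial) n b c where "n \<in> {2, 3}" "s = 0" "\<Delta> = of_nat n - 1" "c \<noteq> 0"
      "f = smult b [:s, \<Delta>:] + monom c n"
proof -
  have at0: "s * poly f l = (s + \<Delta> * l) * poly f 0" for l
    using eq[of l 0] by (simp add: algebra_simps)
  show thesis
  proof (cases "s = 0")
    case False
    have "poly f l = poly (smult (poly f 0 / s) [:s, \<Delta>:]) l" for l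
      using False at0[of l] by (simp add: field_simps)
    then have "f = smult (poly f 0 / s) [:s, \<Delta>:]"
      by (rule poly_ext)
    then show thesis by (rule coboundary)
  next
    case True
    have f0: "poly f 0 = 0"
      using at0[of 1] True assms(1) by simp
    define b where "b = coeff f 1 / \<Delta>"
    define r where "r = f - smult b [:s, \<Delta>:]"
    have f: "f = smult b [:s, \<Delta>:] + r" by (simp add: r_def)
    have eqr: "(l + \<Delta> * m) * poly r l - (m + \<Delta> * l) * poly r m = (l - m) * poly r (l + m)" for l m
      using eq[of l m] True by (simp add: r_def algebra_simps)
    have r0: "poly r 0 = 0" and r1: "coeff r 1 = 0"
      using f0 True assms(1) by (simp_all add: r_def b_def)
    have "smult (\<Delta> + 1) r = [:0, 1:] * pderiv r"
      using L_cocycle_derivative[OF eqr r0] r1 by simp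
    then have smult_r: "coeff (smult (\<Delta> + 1) r) n = coeff ([:0, 1:] * pderiv r) n" for n
      by simp
    have euler: "(\<Delta> + 1 - of_nat n) * coeff r n = 0" for n
    proof (cases n)
      case 0
      then show ?thesis using r0 by (simp add: poly_0_coeff_0)
    next
      case (Suc k)
      then show ?thesis using smult_r[of n] by (simp add: coeff_pderiv algebra_simps)
    qed
    show thesis
    proof (cases "r = 0")
      case True
      with f show thesis by (intro coboundary[of b]) simp
    next
      case False
      then obtain n where n: "coeff r n \<noteq> 0" by (auto simp: poly_eq_iff)
      then have Dn: "\<Delta> = of_nat n - 1"
        using euler[of n] by (auto simp: eq_diff_eq)
      have rn: "r = monom (coeff r n) n"
        by (rule poly_eqI) (use euler Dn in auto)
      have "n \<noteq> 0" "n \<noteq> 1" using n r0 r1 by (metis poly_0_coeff_0)+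
      then have "2 \<le> n" by simp
      moreover have "(l + \<Delta> * m) * (coeff r n * l ^ n) - (m + \<Delta> * l) * (coeff r n * m ^ n)
          = (l - m) * (coeff r n * (l + m) ^ n)" for l m
        using eqr[of l m] rn by (metis poly_monom)
      ultimately have "n \<in> {2, 3}"
        using monom_L_cocycle n Dn by blast
      then show thesis
        using monomial \<open>s = 0\<close> Dn n f rn by metis
    qed
  qed
qed

section \<open>Classification and Ext\<close>

text \<open>
  The classification. It remains to exclude \<open>g(\<lambda>) = \<lambda> g(1)\<close> for \<open>s = 0\<close>, \<open>\<Delta> = 1\<close>: with \<open>\<mu> = 0\<close>
  the equation for \<open>f\<close> says \<open>g(\<lambda>) = - f(0)\<close> for all \<open>\<lambda> \<noteq> 0\<close>, so that \<open>g(2) = g(1)\<close>.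
\<close>

lemma extension_trivial_or_monomial:
  assumes \<Delta>: "\<Delta> \<noteq> 0" and ext: "is_extension (mod_C \<gamma>) (mod_V \<alpha> \<Delta>) E i p"
  obtains (trivial) "trivial_ext (mod_C \<gamma>) (mod_V \<alpha> \<Delta>) E i p"
  | (monomial) n c where "n \<in> {2, 3}" "\<alpha> + \<gamma> = 0" "\<Delta> = of_nat n - 1" "c \<noteq> 0"
      "ext_equiv E i p (mod_E \<alpha> \<gamma> \<Delta> (monom c n) 0) incl snd"
proof -
  obtain f g where Z: "E_cocycle \<gamma> f g \<in> cocycles (mod_V \<alpha> \<Delta>) (mod_C \<gamma>)"
    and E: "ext_equiv E i p (mod_E \<alpha> \<gamma> \<Delta> f g) incl snd"
    using extension_equiv_mod_E[OF ext] .
  have LL: "(\<alpha> + \<gamma> + l + \<Delta> * m) * poly f l - (\<alpha> + \<gamma> + m + \<Delta> * l) * poly f m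
         = (l - m) * (poly f (l + m) + poly g (l + m))"
    and IL: "(\<alpha> + \<gamma> + m + \<Delta> * l) * poly g m = m * poly g (l + m)" for l m
    using Z unfolding E_cocycle_in_cocycles_iff by blast+
  note g = I_cocycle_eq_imp[OF \<Delta> IL]
  have "poly g 1 = 0"
  proof (rule ccontr)
    assume "poly g 1 \<noteq> 0"
    then have s: "\<alpha> + \<gamma> = 0" "\<Delta> = 1" using g(2) by auto
    have "poly g 2 = 2 * poly g 1" using g(1)[of 2] .
    moreover have "- poly f 0 = poly g 1" "- 2 * poly f 0 = 2 * poly g 2"
      using LL[of 1 0] LL[of 2 0] s by simp_all
    ultimately have "poly g 1 = 0" by simp
    with \<open>poly g 1 \<noteq> 0\<close> show False ..
  qed
  then have "poly g x = poly 0 x" for x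
    using g(1)[of x] by simp
  then have "g = 0"
    by (rule poly_ext)
  then have "(\<alpha> + \<gamma> + l + \<Delta> * m) * poly f l - (\<alpha> + \<gamma> + m + \<Delta> * l) * poly f m
         = (l - m) * poly f (l + m)" for l m
    using LL[of l m] by simp
  from \<Delta> this show thesis
  proof (cases rule: L_cocycle_eq_cases)
    case (coboundary b)
    then have "ext_equiv (mod_E \<alpha> \<gamma> \<Delta> f g) incl snd (mod_E \<alpha> \<gamma> \<Delta> 0 0) incl snd"
      unfolding ext_equiv_mod_E_iff using \<open>g = 0\<close> by (intro conjI exI[of _ b]) simp_all
    from ext_equiv_trans[OF E this] show ?thesis
      by (intro trivial) (simp add: trivial_ext_def direct_sum_eq_mod_E)
  next
    case (monomial n b c)
    then have "ext_equiv (mod_E \<alpha> \<gamma> \<Delta> f g) incl snd (mod_E \<alpha> \<gamma> \<Delta> (monom c n) 0) incl snd"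
      unfolding ext_equiv_mod_E_iff using \<open>g = 0\<close> by (intro conjI exI[of _ b]) simp_all
    from ext_equiv_trans[OF E this] monomial show ?thesis
      by (intro that(2)) auto
  qed
qed

lemma monom_in_cocycles:
  assumes "n \<in> {2, 3}" "\<alpha> + \<gamma> = 0" "\<Delta> = of_nat n - 1"
  shows "E_cocycle \<gamma> (monom c n) 0 \<in> cocycles (mod_V \<alpha> \<Delta>) (mod_C \<gamma>)"
proof -
  consider "n = 2" "\<Delta> = 1" | "n = 3" "\<Delta> = 2"
    using assms(1,3) by auto
  then show ?thesis
    unfolding E_cocycle_in_cocycles_iff assms(2)
    by cases (simp_all add: poly_monom power2_eq_square power3_eq_cube algebra_simps)
qed

text \<open>
  For \<open>\<alpha> + \<gamma> = 0\<close> coboundaries are multiples of \<open>\<Delta>\<lambda>\<close>, hence have no term of degree at least \<open>2\<close>.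
\<close>

lemma trivial_ext_mod_E_monom_iff:
  assumes "2 \<le> n" "\<alpha> + \<gamma> = 0"
  shows "trivial_ext (mod_C \<gamma>) (mod_V \<alpha> \<Delta>) (mod_E \<alpha> \<gamma> \<Delta> (monom c n) 0) incl snd \<longleftrightarrow> c = 0"
proof
  assume "trivial_ext (mod_C \<gamma>) (mod_V \<alpha> \<Delta>) (mod_E \<alpha> \<gamma> \<Delta> (monom c n) 0) incl snd"
  then obtain b where "monom c n = smult b [:0, \<Delta>:]"
    unfolding trivial_ext_def direct_sum_eq_mod_E ext_equiv_mod_E_iff using assms(2) by auto
  then have "coeff (monom c n) n = coeff (smult b [:0, \<Delta>:]) n"
    by (rule arg_cong)
  then show "c = 0"
    using assms(1) by (simp add: coeff_pCons split: nat.splits)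
next
  assume "c = 0"
  then show "trivial_ext (mod_C \<gamma>) (mod_V \<alpha> \<Delta>) (mod_E \<alpha> \<gamma> \<Delta> (monom c n) 0) incl snd"
    unfolding trivial_ext_def direct_sum_eq_mod_E ext_equiv_mod_E_iff by (auto intro: exI[of _ 0])
qed

lemma nontrivial_ext_mod_E_monom:
  assumes "n \<in> {2, 3}" "\<alpha> + \<gamma> = 0" "\<Delta> = of_nat n - 1" "c \<noteq> 0"
  shows "nontrivial_ext (mod_C \<gamma>) (mod_V \<alpha> \<Delta>) (mod_E \<alpha> \<gamma> \<Delta> (monom c n) 0) incl snd"
proof -
  have "is_extension (mod_C \<gamma>) (mod_V \<alpha> \<Delta>) (mod_E \<alpha> \<gamma> \<Delta> (monom c n) 0) incl snd"
    using monom_in_cocycles[OF assms(1-3), of c] by (simp add: mod_E_eq_cochain_mod cocycles_def)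
  moreover have "2 \<le> n" using assms(1) by auto
  ultimately show ?thesis
    using assms(2,4) by (simp add: nontrivial_ext_def trivial_ext_mod_E_monom_iff)
qed

lemma quot_one_dimensionalI:
  assumes vs: "vector_space s" and Z: "module.subspace s Z" and B: "module.subspace s B"
    and "B \<subseteq> Z" and "e \<in> Z" and ex1: "\<And>x. x \<in> Z \<Longrightarrow> \<exists>!c. x - s c e \<in> B"
  shows "quot_one_dimensional s Z B"
proof -
  interpret vector_space s by (rule vs)
  define coset where "coset x = {x + b |b. b \<in> B}" for x
  have coset_eq: "coset x = coset y \<longleftrightarrow> x - y \<in> B" for x y
  proof
    assume "coset x = coset y"
    moreover have "x \<in> coset x"
      using subspace_0[OF B] by (auto simp: coset_def intro!: exI[of _ 0])
    ultimately show "x - y \<in> B"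
      by (auto simp: coset_def)
  next
    assume xy: "x - y \<in> B"
    have "x + b \<in> coset y" "y + b \<in> coset x" if "b \<in> B" for b
    proof -
      have "x + b = y + ((x - y) + b)" "y + b = x + (b - (x - y))" by simp_all
      then show "x + b \<in> coset y" "y + b \<in> coset x"
        using subspace_add[OF B xy that] subspace_diff[OF B that xy]
        unfolding coset_def by blast+
    qed
    then show "coset x = coset y"
      by (auto simp: coset_def)
  qed
  have scale: "quot_scale s B c (coset x) = coset (s c x)" for c x
  proof -
    have "s c (x + b) + b' = s c x + (s c b + b')" for b b'
      by (simp add: scale_right_distrib add.assoc)
    moreover have "s c x + b = s c (x + 0) + b" for b by simp
    ultimately show ?thesis
      unfolding quot_scale_def coset_def
      using subspace_0[OF B] subspace_add[OF B] subspace_scale[OF B] by blast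
  qed
  have "quot_space Z B = coset ` Z"
    by (simp add: quot_space_def coset_def)
  then show ?thesis
    unfolding quot_one_dimensional_def
    using assms coset_eq scale by (intro conjI bexI[of _ "coset e"]) auto
qed

text \<open>
  The class of \<open>\<lambda>\<^sup>n\<close> is a basis: by the classification every cocycle is equivalent to a multiple of
  it, and the multiple is unique since no nonzero multiple is a coboundary.
\<close>

lemma Ext_one_dimensional_monom:
  assumes n: "n \<in> {2, 3}" and s: "\<alpha> + \<gamma> = 0" and \<Delta>: "\<Delta> = of_nat n - 1"
  shows "Ext_one_dimensional (mod_V \<alpha> \<Delta>) (mod_C \<gamma>)"
proof -
  let ?V = "mod_C \<gamma>" and ?W = "mod_V \<alpha> \<Delta>"
  note V = conformal_module_mod_C[of \<gamma>] and W = conformal_module_mod_V[of \<alpha> \<Delta>]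
  let ?e = "E_cocycle \<gamma> (monom 1 n) 0"
  have vs: "vector_space (cochain_scale ?V)"
    by (rule vector_space_cochain_scale[OF conformal_moduleD(1)[OF V]])
  interpret vector_space "cochain_scale ?V" by (rule vs)
  note Z = subspace_cocycles[OF V W] and B = subspace_coboundaries[OF V W]
  have scale_e: "cochain_scale ?V c ?e = E_cocycle \<gamma> (monom c n) 0" for c
    by (simp add: cochain_scale_def E_cocycle_def poly_monom fun_eq_iff)
  have "2 \<le> n" "\<Delta> \<noteq> 0" using n \<Delta> by auto
  have "quot_one_dimensional (cochain_scale ?V) (cocycles ?W ?V) (coboundaries ?W ?V)"
  proof (rule quot_one_dimensionalI[OF vs Z B])
    show "coboundaries ?W ?V \<subseteq> cocycles ?W ?V"
      by (auto simp: coboundaries_def)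
    show "?e \<in> cocycles ?W ?V"
      by (rule monom_in_cocycles[OF n s \<Delta>])
    fix z assume z: "z \<in> cocycles ?W ?V"
    show "\<exists>!c. z - cochain_scale ?V c ?e \<in> coboundaries ?W ?V"
    proof (rule ex_ex1I)
      have "is_extension ?V ?W (cochain_mod ?V ?W z) incl snd"
        using z by (simp add: cocycles_def)
      from \<open>\<Delta> \<noteq> 0\<close> this show "\<exists>c. z - cochain_scale ?V c ?e \<in> coboundaries ?W ?V"
      proof (cases rule: extension_trivial_or_monomial)
        case trivial
        then have "z - cochain_scale ?V 0 ?e \<in> coboundaries ?W ?V"
          using z by (simp add: coboundaries_def)
        then show ?thesis by blast
      next
        case (monomial n' c)
        then have "n' = n" using \<Delta> by (metis diff_add_cancel of_nat_eq_iff)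
        with monomial(5) have "z - E_cocycle \<gamma> (monom c n) 0 \<in> coboundaries ?W ?V"
          by (intro equivalent_cocycles_diff z monom_in_cocycles[OF n s \<Delta>])
            (simp add: mod_E_eq_cochain_mod)
        then show ?thesis unfolding scale_e by blast
      qed
    next
      fix c c' assume "z - cochain_scale ?V c ?e \<in> coboundaries ?W ?V"
        "z - cochain_scale ?V c' ?e \<in> coboundaries ?W ?V"
      from subspace_diff[OF B this(2,1)]
      have "cochain_scale ?V (c - c') ?e \<in> coboundaries ?W ?V"
        by (simp add: scale_left_diff_distrib)
      then have "trivial_ext ?V ?W (mod_E \<alpha> \<gamma> \<Delta> (monom (c - c') n) 0) incl snd"
        unfolding scale_e by (simp add: coboundaries_def mod_E_eq_cochain_mod)
      then show "c = c'"
        unfolding trivial_ext_mod_E_monom_iff[OF \<open>2 \<le> n\<close> s] by simp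
    qed
  qed
  then show ?thesis
    by (simp add: Ext_one_dimensional_def)
qed

theorem theorem4p3:
  fixes \<alpha> \<gamma> \<Delta> :: complex
  assumes "\<Delta> \<noteq> 0"
  shows
    "((\<exists>(E :: (complex \<times> complex poly) conf_mod) i p.
         nontrivial_ext (mod_C \<gamma>) (mod_V \<alpha> \<Delta>) E i p)
       \<longleftrightarrow> \<alpha> + \<gamma> = 0 \<and> (\<Delta> = 1 \<or> \<Delta> = 2))
   \<and> (\<forall>(E :: 'e::ab_group_add conf_mod) i p.
         nontrivial_ext (mod_C \<gamma>) (mod_V \<alpha> \<Delta>) E i p \<longrightarrow> \<alpha> + \<gamma> = 0 \<and> (\<Delta> = 1 \<or> \<Delta> = 2))
   \<and> (\<alpha> + \<gamma> = 0 \<and> \<Delta> = 1 \<longrightarrow>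
         (\<forall>b2. b2 \<noteq> 0 \<longrightarrow>
            nontrivial_ext (mod_C \<gamma>) (mod_V \<alpha> \<Delta>) (mod_E \<alpha> \<gamma> \<Delta> (monom b2 2) 0) incl snd)
       \<and> (\<forall>(E :: 'e conf_mod) i p. nontrivial_ext (mod_C \<gamma>) (mod_V \<alpha> \<Delta>) E i p \<longrightarrow>
            (\<exists>b2. b2 \<noteq> 0 \<and> ext_equiv E i p (mod_E \<alpha> \<gamma> \<Delta> (monom b2 2) 0) incl snd)))
   \<and> (\<alpha> + \<gamma> = 0 \<and> \<Delta> = 2 \<longrightarrow>
         (\<forall>b3. b3 \<noteq> 0 \<longrightarrow>
            nontrivial_ext (mod_C \<gamma>) (mod_V \<alpha> \<Delta>) (mod_E \<alpha> \<gamma> \<Delta> (monom b3 3) 0) incl snd)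
       \<and> (\<forall>(E :: 'e conf_mod) i p. nontrivial_ext (mod_C \<gamma>) (mod_V \<alpha> \<Delta>) E i p \<longrightarrow>
            (\<exists>b3. b3 \<noteq> 0 \<and> ext_equiv E i p (mod_E \<alpha> \<gamma> \<Delta> (monom b3 3) 0) incl snd)))
   \<and> Ext_one_dimensional (mod_V \<alpha> 1) (mod_C (- \<alpha>))
   \<and> Ext_one_dimensional (mod_V \<alpha> 2) (mod_C (- \<alpha>))"
proof -
  have classify: "\<alpha> + \<gamma> = 0 \<and> (\<exists>n \<in> {2, 3}. \<Delta> = of_nat n - 1 \<and>
      (\<exists>c. c \<noteq> 0 \<and> ext_equiv E i p (mod_E \<alpha> \<gamma> \<Delta> (monom c n) 0) incl snd))"
    if "nontrivial_ext (mod_C \<gamma>) (mod_V \<alpha> \<Delta>) E i p"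
    for E :: "'f::ab_group_add conf_mod" and i p
    using that extension_trivial_or_monomial[OF assms, of \<gamma> \<alpha> E i p]
    unfolding nontrivial_ext_def by metis
  have nontrivial: "nontrivial_ext (mod_C \<gamma>) (mod_V \<alpha> \<Delta>) (mod_E \<alpha> \<gamma> \<Delta> (monom c n) 0) incl snd"
    if "\<alpha> + \<gamma> = 0" "n \<in> {2, 3}" "\<Delta> = of_nat n - 1" "c \<noteq> 0" for c n
    using nontrivial_ext_mod_E_monom that by blast
  have parameters: "\<alpha> + \<gamma> = 0 \<and> (\<Delta> = 1 \<or> \<Delta> = 2)"
    if "nontrivial_ext (mod_C \<gamma>) (mod_V \<alpha> \<Delta>) E i p"
    for E :: "'f::ab_group_add conf_mod" and i p
    using classify[OF that] by auto
  have form: "\<exists>c. c \<noteq> 0 \<and> ext_equiv E i p (mod_E \<alpha> \<gamma> \<Delta> (monom c n) 0) incl snd"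
    if \<Delta>: "\<Delta> = of_nat n - 1" and E: "nontrivial_ext (mod_C \<gamma>) (mod_V \<alpha> \<Delta>) E i p"
    for E :: "'f::ab_group_add conf_mod" and i p n
  proof -
    obtain n' where "\<Delta> = of_nat n' - 1"
      "\<exists>c. c \<noteq> 0 \<and> ext_equiv E i p (mod_E \<alpha> \<gamma> \<Delta> (monom c n') 0) incl snd"
      using classify[OF E] by blast
    moreover from this(1) \<Delta> have "n' = n"
      by (metis diff_add_cancel of_nat_eq_iff)
    ultimately show ?thesis by simp
  qed
  have exists: "\<exists>(E :: (complex \<times> complex poly) conf_mod) i p. nontrivial_ext (mod_C \<gamma>) (mod_V \<alpha> \<Delta>) E i p"
    if "\<alpha> + \<gamma> = 0" "\<Delta> = 1 \<or> \<Delta> = 2"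
    using that(2)
  proof
    assume "\<Delta> = 1"
    then show ?thesis using nontrivial[of 2 1] that(1) by auto
  next
    assume "\<Delta> = 2"
    then show ?thesis using nontrivial[of 3 1] that(1) by auto
  qed
  show ?thesis
  proof (intro conjI)
    show "(\<exists>(E :: (complex \<times> complex poly) conf_mod) i p.
        nontrivial_ext (mod_C \<gamma>) (mod_V \<alpha> \<Delta>) E i p) \<longleftrightarrow> \<alpha> + \<gamma> = 0 \<and> (\<Delta> = 1 \<or> \<Delta> = 2)"
      using parameters exists by blast
    show "\<forall>(E :: 'e conf_mod) i p.
        nontrivial_ext (mod_C \<gamma>) (mod_V \<alpha> \<Delta>) E i p \<longrightarrow> \<alpha> + \<gamma> = 0 \<and> (\<Delta> = 1 \<or> \<Delta> = 2)"
      using parameters by blast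
    show "\<alpha> + \<gamma> = 0 \<and> \<Delta> = 1 \<longrightarrow>
         (\<forall>b2. b2 \<noteq> 0 \<longrightarrow>
            nontrivial_ext (mod_C \<gamma>) (mod_V \<alpha> \<Delta>) (mod_E \<alpha> \<gamma> \<Delta> (monom b2 2) 0) incl snd)
       \<and> (\<forall>(E :: 'e conf_mod) i p. nontrivial_ext (mod_C \<gamma>) (mod_V \<alpha> \<Delta>) E i p \<longrightarrow>
            (\<exists>b2. b2 \<noteq> 0 \<and> ext_equiv E i p (mod_E \<alpha> \<gamma> \<Delta> (monom b2 2) 0) incl snd))"
      by (intro impI conjI allI; (rule nontrivial | rule form); simp)
    show "\<alpha> + \<gamma> = 0 \<and> \<Delta> = 2 \<longrightarrow>
         (\<forall>b3. b3 \<noteq> 0 \<longrightarrow>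
            nontrivial_ext (mod_C \<gamma>) (mod_V \<alpha> \<Delta>) (mod_E \<alpha> \<gamma> \<Delta> (monom b3 3) 0) incl snd)
       \<and> (\<forall>(E :: 'e conf_mod) i p. nontrivial_ext (mod_C \<gamma>) (mod_V \<alpha> \<Delta>) E i p \<longrightarrow>
            (\<exists>b3. b3 \<noteq> 0 \<and> ext_equiv E i p (mod_E \<alpha> \<gamma> \<Delta> (monom b3 3) 0) incl snd))"
      by (intro impI conjI allI; (rule nontrivial | rule form); simp)
    show "Ext_one_dimensional (mod_V \<alpha> 1) (mod_C (- \<alpha>))"
      by (rule Ext_one_dimensional_monom[of 2]) simp_all
    show "Ext_one_dimensional (mod_V \<alpha> 2) (mod_C (- \<alpha>))"
      by (rule Ext_one_dimensional_monom[of 3]) simp_all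
  qed
qed

end
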